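(* Let $0<t_1<t_2$, let $W$ be a standard Brownian motion, let $S(t)=\exp(W(t)-t/2)$, $S_n=S(t_n)$, and let the basis functions $\psi_k$, $k\ge0$, be the multiples of the powers $x^k$ for which $\psi_k(S(t))=e^{kW(t)-k^2t/2}$. Suppose $Y=\sum_{k=0}^{K}a_k\psi_k(S_2)$ for some real constants $a_0,\dots,a_K$, and let $\beta$, $\tilde\beta$ and $\mathsf{MSE}(\tilde\beta)=\mathsf{E}[|\tilde\beta-\beta|^2]$ be the regression coefficient vector, its estimator from $N$ independent replications, and its mean square error, as defined in the context. The supremum below is over all $(a_0,\dots,a_K)\in\mathbb{R}^{K+1}$ for which the resulting $\beta$ satisfies $|\beta|=1$. (i) If $K=K_N=\left\lfloor\sqrt{\frac{(1-\delta)\log N}{5t_1+t_2}}\right\rfloor$ for some $\delta\in(0,1)$, then $$\lim_{N\to\infty}\ \sup_{|\beta|=1}\mathsf{MSE}(\tilde\beta)=0.$$ (ii) If $K=K_N=\left\lfloor\sqrt{\frac{(1+\delta)\log N}{3t_1+t_2}}\right\rfloor$ for some $\delta>0$, then $$\lim_{N\to\infty}\ \sup_{|\beta|=1}\mathsf{MSE}(\tilde\beta)=\infty.$$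
   Context: $\log$ is the natural logarithm, $|\cdot|$ is the Euclidean norm on vectors. The multiple of $x^k$ defining $\psi_k$ depends on the time $t$ at which it is evaluated; only the random variables $\psi_k(S(t))=e^{kW(t)-k^2t/2}$ matter. Single-period regression problem: for given $K$, let $\psi(S_1)=(\psi_0(S_1),\dots,\psi_K(S_1))^\top$, $\Psi=\mathsf{E}[\psi(S_1)\psi(S_1)^\top]$ (an invertible matrix), $\gamma=\mathsf{E}[Y\psi(S_1)]\in\mathbb{R}^{K+1}$, and $\beta=(\beta_0,\dots,\beta_K)^\top=\Psi^{-1}\gamma$. Given $N$ independent copies $(S_1^{(i)},Y^{(i)})$, $i=1,\dots,N$, of $(S_1,Y)$, let $\tilde\gamma$ have components $\tilde\gamma_k=\frac1N\sum_{i=1}^N Y^{(i)}\psi_k(S_1^{(i)})$, $k=0,\dots,K$, and let $\tilde\beta=\Psi^{-1}\tilde\gamma$. The mean square error is $\mathsf{MSE}(\tilde\beta)=\mathsf{E}[|\tilde\beta-\beta|^2]$. *)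

theory Defs
  imports
    "HOL-Probability.Probability"
    "Jordan_Normal_Form.Gauss_Jordan_Elimination"
begin

no_notation vec_nth (infixl "$" 90)

definition standard_brownian_motion ::
    "'a measure \<Rightarrow> (real \<Rightarrow> 'a \<Rightarrow> real) \<Rightarrow> bool" where
  "standard_brownian_motion M W \<longleftrightarrow>
     prob_space M \<and>
     (\<forall>t\<ge>0. W t \<in> borel_measurable M) \<and>
     (AE \<omega> in M. W 0 \<omega> = 0) \<and>
     (\<forall>(n::nat) (\<tau> :: nat \<Rightarrow> real). 0 \<le> \<tau> 0 \<and> (\<forall>i<n. \<tau> i \<le> \<tau> (Suc i)) \<longrightarrow>
        prob_space.indep_vars M (\<lambda>_. borel) (\<lambda>i \<omega>. W (\<tau> (Suc i)) \<omega> - W (\<tau> i) \<omega>) {..<n}) \<and>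
     (\<forall>s t. 0 \<le> s \<and> s < t \<longrightarrow>
        distributed M lborel (\<lambda>\<omega>. W t \<omega> - W s \<omega>) (normal_density 0 (sqrt (t - s)))) \<and>
     (AE \<omega> in M. continuous_on {0..} (\<lambda>t. W t \<omega>))"

definition geometric_bm :: "(real \<Rightarrow> 'a \<Rightarrow> real) \<Rightarrow> real \<Rightarrow> 'a \<Rightarrow> real" where
  "geometric_bm W t \<omega> = exp (W t \<omega> - t / 2)"

text \<open>The \<open>k\<close>-th basis function at time \<open>t\<close>: the multiple of \<open>x ^ k\<close> whose constant
  is determined by the lemma below.\<close>

definition psi :: "real \<Rightarrow> nat \<Rightarrow> real \<Rightarrow> real" where
  "psi t k x = exp (- (real k * (real k - 1) * t / 2)) * x ^ k"

lemma psi_geometric_bm: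
  "psi t k (geometric_bm W t \<omega>) = exp (real k * W t \<omega> - (real k)\<^sup>2 * t / 2)"
proof -
  have "psi t k (geometric_bm W t \<omega>) =
      exp (- (real k * (real k - 1) * t / 2)) * exp (real k * (W t \<omega> - t / 2))"
    by (simp add: psi_def geometric_bm_def exp_of_nat_mult)
  also have "\<dots> = exp (real k * W t \<omega> - (real k)\<^sup>2 * t / 2)"
    by (simp add: exp_add [symmetric] field_simps power2_eq_square)
  finally show ?thesis .
qed

definition indep_copies ::
    "'b measure \<Rightarrow> nat \<Rightarrow> (nat \<Rightarrow> 'b \<Rightarrow> 'c) \<Rightarrow> 'a measure \<Rightarrow> 'c measure \<Rightarrow> ('a \<Rightarrow> 'c) \<Rightarrow> bool" where
  "indep_copies P N Z M L X \<longleftrightarrow>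
     prob_space P \<and>
     prob_space.indep_vars P (\<lambda>_. L) Z {1..N} \<and>
     (\<forall>i\<in>{1..N}. distr P L (Z i) = distr M L X)"

text \<open>Regression of \<open>Y\<close> on \<open>\<phi> 0 (X), \<dots>, \<phi> K (X)\<close>; vectors and matrices are indexed by
  \<open>0, \<dots>, K\<close>. The Gram matrix considered below is invertible, so \<open>the\<close> selects its inverse.\<close>

definition gram_matrix ::
    "'a measure \<Rightarrow> nat \<Rightarrow> (nat \<Rightarrow> real \<Rightarrow> real) \<Rightarrow> ('a \<Rightarrow> real) \<Rightarrow> real mat" where
  "gram_matrix M K \<phi> X =
     mat (Suc K) (Suc K) (\<lambda>(j, k). \<integral>\<omega>. \<phi> j (X \<omega>) * \<phi> k (X \<omega>) \<partial>M)"

definition cross_moments ::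
    "'a measure \<Rightarrow> nat \<Rightarrow> (nat \<Rightarrow> real \<Rightarrow> real) \<Rightarrow> ('a \<Rightarrow> real) \<Rightarrow> ('a \<Rightarrow> real) \<Rightarrow> real vec" where
  "cross_moments M K \<phi> X Y = vec (Suc K) (\<lambda>k. \<integral>\<omega>. Y \<omega> * \<phi> k (X \<omega>) \<partial>M)"

definition regression_coeff ::
    "'a measure \<Rightarrow> nat \<Rightarrow> (nat \<Rightarrow> real \<Rightarrow> real) \<Rightarrow> ('a \<Rightarrow> real) \<Rightarrow> ('a \<Rightarrow> real) \<Rightarrow> real vec" where
  "regression_coeff M K \<phi> X Y =
     the (mat_inverse (gram_matrix M K \<phi> X)) *\<^sub>v cross_moments M K \<phi> X Y"

definition empirical_cross_moments ::
    "nat \<Rightarrow> (nat \<Rightarrow> real \<Rightarrow> real) \<Rightarrow> nat \<Rightarrow> (nat \<Rightarrow> 'b \<Rightarrow> real \<times> real) \<Rightarrow> 'b \<Rightarrow> real vec" where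
  "empirical_cross_moments K \<phi> N Z \<omega> =
     vec (Suc K) (\<lambda>k. 1 / real N * (\<Sum>i=1..N. snd (Z i \<omega>) * \<phi> k (fst (Z i \<omega>))))"

definition regression_estimator ::
    "'a measure \<Rightarrow> nat \<Rightarrow> (nat \<Rightarrow> real \<Rightarrow> real) \<Rightarrow> ('a \<Rightarrow> real) \<Rightarrow>
     nat \<Rightarrow> (nat \<Rightarrow> 'b \<Rightarrow> real \<times> real) \<Rightarrow> 'b \<Rightarrow> real vec" where
  "regression_estimator M K \<phi> X N Z \<omega> =
     the (mat_inverse (gram_matrix M K \<phi> X)) *\<^sub>v empirical_cross_moments K \<phi> N Z \<omega>"

definition euclidean_norm :: "real vec \<Rightarrow> real" where
  "euclidean_norm v = L2_set (\<lambda>i. v $ i) {..<dim_vec v}"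

text \<open>Taken in \<open>ennreal\<close>, so that neither the expectation nor a supremum of such values
  can silently default to a junk value.\<close>

definition mean_square_error :: "'b measure \<Rightarrow> ('b \<Rightarrow> real vec) \<Rightarrow> real vec \<Rightarrow> ennreal" where
  "mean_square_error P b' b = (\<integral>\<^sup>+\<omega>. ennreal ((euclidean_norm (b' \<omega> - b))\<^sup>2) \<partial>P)"

definition payoff ::
    "(real \<Rightarrow> 'a \<Rightarrow> real) \<Rightarrow> real \<Rightarrow> nat \<Rightarrow> real vec \<Rightarrow> 'a \<Rightarrow> real" where
  "payoff W t K a \<omega> = (\<Sum>k\<le>K. a $ k * psi t k (geometric_bm W t \<omega>))"

definition bm_coeff ::
    "'a measure \<Rightarrow> (real \<Rightarrow> 'a \<Rightarrow> real) \<Rightarrow> real \<Rightarrow> real \<Rightarrow> nat \<Rightarrow> real vec \<Rightarrow> real vec" where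
  "bm_coeff M W t\<^sub>1 t\<^sub>2 K a =
     regression_coeff M K (psi t\<^sub>1) (geometric_bm W t\<^sub>1) (payoff W t\<^sub>2 K a)"

definition worst_case_mse ::
    "'a measure \<Rightarrow> (real \<Rightarrow> 'a \<Rightarrow> real) \<Rightarrow> real \<Rightarrow> real \<Rightarrow>
     (nat \<Rightarrow> nat \<Rightarrow> real vec \<Rightarrow> 'b measure) \<Rightarrow>
     (nat \<Rightarrow> nat \<Rightarrow> real vec \<Rightarrow> nat \<Rightarrow> 'b \<Rightarrow> real \<times> real) \<Rightarrow> nat \<Rightarrow> nat \<Rightarrow> ennreal" where
  "worst_case_mse M W t\<^sub>1 t\<^sub>2 P Z N K =
     (SUP a \<in> {a \<in> carrier_vec (Suc K). euclidean_norm (bm_coeff M W t\<^sub>1 t\<^sub>2 K a) = 1}.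
        mean_square_error (P N K a)
          (regression_estimator M K (psi t\<^sub>1) (geometric_bm W t\<^sub>1) N (Z N K a))
          (bm_coeff M W t\<^sub>1 t\<^sub>2 K a))"

end

theory Submission
  imports
    Defs
    "HOL-Real_Asymp.Real_Asymp"
    "Jordan_Normal_Form.Determinant"
begin

text \<open>
  Since \<open>E[\<psi>\<^sub>m(S\<^sub>2) \<psi>\<^sub>k(S\<^sub>1)] = E[\<psi>\<^sub>m(S\<^sub>1) \<psi>\<^sub>k(S\<^sub>1)] = exp (m k t\<^sub>1)\<close>, the coefficient vector is
  \<open>\<beta> = a\<close>, and the mean square error is \<open>(\<Sum>\<^sub>k E[Y\<^sup>2 \<chi>\<^sub>k(S\<^sub>1)\<^sup>2] - |a|\<^sup>2) / N\<close> with \<open>\<chi> = \<Psi>\<^sup>-\<^sup>1 \<psi>\<close>. All moments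
  are controlled by \<open>E[\<psi>\<^sub>m(S\<^sub>2)\<^sup>2 \<psi>\<^sub>k(S\<^sub>1)\<^sup>2] = exp (m\<^sup>2 t\<^sub>2 + k\<^sup>2 t\<^sub>1 + 4 m k t\<^sub>1)\<close>, which for \<open>m, k \<le> K\<close> is at most
  \<open>exp (K\<^sup>2 (5 t\<^sub>1 + t\<^sub>2))\<close>. The matrix \<open>\<Psi>\<close> is the Vandermonde matrix of the nodes \<open>exp (i t\<^sub>1)\<close>, and the
  Lagrange polynomials show that the entries of its inverse are at most \<open>C ^ K\<close>; as \<open>K\<^sup>2\<close> is of order
  \<open>ln N\<close>, this is negligible against any power of \<open>N\<close>, which gives (i). For (ii) take \<open>Y = \<psi>\<^sub>K(S\<^sub>2)\<close>:
  \<open>\<psi>\<^sub>K = (\<Psi> \<chi>)\<^sub>K\<close> and Cauchy--Schwarz bound \<open>|\<chi>|\<^sup>2\<close> from below by \<open>\<psi>\<^sub>K\<^sup>2 exp (- 2 K\<^sup>2 t\<^sub>1) / (K + 1)\<close>, which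
  lowers the exponent from \<open>5 t\<^sub>1 + t\<^sub>2\<close> to \<open>3 t\<^sub>1 + t\<^sub>2\<close>.
\<close>

subsection \<open>Vandermonde matrices with geometric nodes\<close>

text \<open>For finite \<open>A\<close> the coefficients are, up to sign, the elementary symmetric
  sums of the \<open>c m\<close>, and \<open>\<Prod>m\<in>A. 1 + \<bar>c m\<bar>\<close> expands
  into the sum of all products of the \<open>\<bar>c m\<bar>\<close>. The induction adds one linear
  factor at a time, which combines two neighbouring coefficients.\<close>

lemma abs_coeff_prod_linear_le:
  fixes c :: "'i \<Rightarrow> real"
  shows "\<bar>poly.coeff (\<Prod>m\<in>A. [:- c m, 1:]) k\<bar> \<le> (\<Prod>m\<in>A. 1 + \<bar>c m\<bar>)"
proof (induction A arbitrary: k rule: infinite_finite_induct)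
  case (insert m A)
  let ?p = "\<Prod>m\<in>A. [:- c m, 1:]" and ?b = "\<Prod>m\<in>A. 1 + \<bar>c m\<bar>"
  have "\<bar>poly.coeff ([:- c m, 1:] * ?p) k\<bar> \<le> \<bar>c m\<bar> * \<bar>poly.coeff ?p k\<bar> + \<bar>poly.coeff (pCons 0 ?p) k\<bar>"
    using abs_triangle_ineq[of "- (c m * poly.coeff ?p k)" "poly.coeff (pCons 0 ?p) k"]
    by (simp add: abs_mult)
  also have "\<bar>poly.coeff (pCons 0 ?p) k\<bar> \<le> ?b"
    using insert.IH by (cases k) (auto intro: prod_nonneg)
  also have "\<bar>c m\<bar> * \<bar>poly.coeff ?p k\<bar> \<le> \<bar>c m\<bar> * ?b"
    using insert.IH by (intro mult_left_mono) auto
  finally show ?case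
    using insert.hyps by (simp add: algebra_simps)
qed (auto simp: coeff_pCons split: nat.split)

text \<open>Numerator and denominator are compared with the same power of \<open>q\<close>, namely
  \<open>q ^ m\<close> if \<open>m < j\<close> and \<open>q ^ (m - 1)\<close> otherwise: the
  numerator is at most \<open>q + 1\<close> times it, the denominator at least \<open>q - 1\<close>
  times it. The bound is free of \<open>m\<close> and \<open>j\<close>, so a product of
  \<open>K\<close> such quotients is at most a \<open>K\<close>-th power.\<close>

lemma one_plus_power_div_le:
  fixes q :: real
  assumes "1 < q" "m \<noteq> j"
  shows "(1 + q ^ m) / \<bar>q ^ j - q ^ m\<bar> \<le> (q + 1) / (q - 1)"
proof (cases "m < j")
  case True
  have "q ^ m * q \<le> q ^ j"
    using assms True power_increasing[of "Suc m" j q] by (simp add: mult.commute)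
  then have "q ^ m * (q - 1) \<le> \<bar>q ^ j - q ^ m\<bar>"
    by (simp add: algebra_simps)
  moreover have "1 \<le> q ^ m" using assms by (intro one_le_power) simp
  then have "1 + q ^ m \<le> q ^ m * (q + 1)"
    using mult_mono[of 1 q 1 "q ^ m"] assms by (simp add: algebra_simps)
  ultimately have "(1 + q ^ m) / \<bar>q ^ j - q ^ m\<bar> \<le> (q ^ m * (q + 1)) / (q ^ m * (q - 1))"
    using assms by (intro frac_le) auto
  then show ?thesis using assms by simp
next
  case False
  with assms obtain n where n: "m = Suc n" "j \<le> n"
    by (cases m) auto
  have "q ^ j \<le> q ^ n"
    using assms n by (intro power_increasing) auto
  then have "q ^ n * (q - 1) \<le> \<bar>q ^ j - q ^ m\<bar>"
    unfolding n by (simp add: algebra_simps)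
  moreover have "1 \<le> q ^ n" using assms by (intro one_le_power) simp
  then have "1 + q ^ m \<le> q ^ n * (q + 1)"
    unfolding n by (simp add: algebra_simps)
  ultimately have "(1 + q ^ m) / \<bar>q ^ j - q ^ m\<bar> \<le> (q ^ n * (q + 1)) / (q ^ n * (q - 1))"
    using assms by (intro frac_le) auto
  then show ?thesis using assms by simp
qed

text \<open>Column \<open>j\<close> of \<open>B\<close> holds the coefficients of the Lagrange
  polynomial that is 1 at \<open>q ^ j\<close> and 0 at the other nodes; row \<open>i\<close> of the
  Vandermonde matrix evaluates it at \<open>q ^ i\<close>.\<close>

lemma geometric_vandermonde_right_inverse:
  fixes q :: real
  assumes q: "1 < q"
  obtains B where "B \<in> carrier_mat (Suc K) (Suc K)"
    and "mat (Suc K) (Suc K) (\<lambda>(i, k). (q ^ i) ^ k) * B = 1\<^sub>m (Suc K)"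
    and "\<And>k j. k \<le> K \<Longrightarrow> j \<le> K \<Longrightarrow> \<bar>B $$ (k, j)\<bar> \<le> ((q + 1) / (q - 1)) ^ K"
proof
  define d where "d j = (\<Prod>m\<in>{..K} - {j}. q ^ j - q ^ m)" for j
  define p where "p j = (\<Prod>m\<in>{..K} - {j}. [:- (q ^ m), 1:])" for j
  define L where "L j = Polynomial.smult (inverse (d j)) (p j)" for j
  define B where "B = mat (Suc K) (Suc K) (\<lambda>(k, j). poly.coeff (L j) k)"
  have inj: "q ^ j \<noteq> q ^ m" if "m \<noteq> j" for m j
    using that q power_inject_exp[of q j m] by auto
  have d0: "d j \<noteq> 0" for j
    unfolding d_def using inj by (simp add: prod_zero_iff)
  have deg: "degree (L j) \<le> K" if "j \<le> K" for j
  proof -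
    have "degree (p j) \<le> (\<Sum>m\<in>{..K} - {j}. degree [:- (q ^ m), 1:])"
      unfolding p_def by (rule degree_prod_sum_le[unfolded o_def]) simp
    also have "\<dots> = K" using that by simp
    finally show ?thesis unfolding L_def by simp
  qed
  have poly_L: "poly (L j) (q ^ i) = (if i = j then 1 else 0)" if "i \<le> K" "j \<le> K" for i j
  proof (cases "i = j")
    case True
    have "poly (p j) (q ^ j) = d j" unfolding p_def d_def by (simp add: poly_prod)
    with True d0 show ?thesis by (simp add: L_def)
  next
    case False
    with that have "poly (p j) (q ^ i) = 0"
      unfolding p_def by (auto simp: poly_prod prod_zero_iff)
    with False show ?thesis by (simp add: L_def)
  qed
  show "B \<in> carrier_mat (Suc K) (Suc K)" by (simp add: B_def)
  show "mat (Suc K) (Suc K) (\<lambda>(i, k). (q ^ i) ^ k) * B = 1\<^sub>m (Suc K)" (is "?V * B = _")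
  proof (rule eq_matI)
    fix i j assume ij: "i < dim_row (1\<^sub>m (Suc K) :: real mat)" "j < dim_col (1\<^sub>m (Suc K) :: real mat)"
    then have "(?V * B) $$ (i, j) = (\<Sum>k<Suc K. (q ^ i) ^ k * poly.coeff (L j) k)"
      by (simp add: B_def scalar_prod_def atLeast0LessThan del: sum.lessThan_Suc)
    \<comment> \<open>The degree of \<open>L j\<close> is at most \<open>K\<close>, so the sum over
      \<open>k < Suc K\<close> misses no coefficient.\<close>
    also have "\<dots> = (\<Sum>k\<le>degree (L j). poly.coeff (L j) k * (q ^ i) ^ k)"
      using deg[of j] ij
      by (intro sum.mono_neutral_cong_right) (auto simp: coeff_eq_0)
    also have "\<dots> = poly (L j) (q ^ i)" by (simp add: poly_altdef)
    finally show "(?V * B) $$ (i, j) = 1\<^sub>m (Suc K) $$ (i, j)"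
      using ij poly_L[of i j] by simp
  qed (auto simp: B_def)
  fix k j assume "k \<le> K" "j \<le> K"
  then have "\<bar>B $$ (k, j)\<bar> = \<bar>poly.coeff (p j) k\<bar> / \<bar>d j\<bar>"
    by (simp add: B_def L_def abs_mult divide_inverse)
  also have "\<dots> \<le> (\<Prod>m\<in>{..K} - {j}. 1 + \<bar>q ^ m\<bar>) / \<bar>d j\<bar>"
    unfolding p_def by (intro divide_right_mono abs_coeff_prod_linear_le) simp
  \<comment> \<open>Coefficient bound and denominator both have one factor for each of the
    \<open>K\<close> other nodes, and are paired node by node.\<close>
  also have "\<dots> = (\<Prod>m\<in>{..K} - {j}. (1 + q ^ m) / \<bar>q ^ j - q ^ m\<bar>)"
    using q by (simp add: d_def abs_prod prod_dividef)
  also have "\<dots> \<le> (\<Prod>m\<in>{..K} - {j}. (q + 1) / (q - 1))"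
    using q by (intro prod_mono conjI one_plus_power_div_le) auto
  also have "\<dots> = ((q + 1) / (q - 1)) ^ K"
    using \<open>j \<le> K\<close> by simp
  finally show "\<bar>B $$ (k, j)\<bar> \<le> ((q + 1) / (q - 1)) ^ K" .
qed

text \<open>A right inverse of a square matrix over a field is also a left inverse, so
  \<open>A\<close> is a unit and \<open>mat_inverse\<close> cannot return \<open>None\<close>;
  uniqueness of inverses identifies its result with \<open>B\<close>.\<close>

lemma the_mat_inverse_eqI:
  fixes A :: "'a :: field mat"
  assumes A: "A \<in> carrier_mat n n" and B: "B \<in> carrier_mat n n" and AB: "A * B = 1\<^sub>m n"
  shows "the (mat_inverse A) = B"
proof -
  have BA: "B * A = 1\<^sub>m n" by (rule mat_mult_left_right_inverse[OF A B AB])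
  then have "A \<in> Units (ring_mat TYPE('a) n ())"
    using A B AB unfolding Units_def ring_mat_simps by auto
  then obtain C where C: "mat_inverse A = Some C"
    using mat_inverse(1)[OF A, of "()"] by (cases "mat_inverse A") auto
  from mat_inverse(2)[OF A this] have AC: "A * C = 1\<^sub>m n" "C \<in> carrier_mat n n" by auto
  have "C = (B * A) * C" using AC BA by simp
  also have "\<dots> = B * (A * C)" using A B AC by (intro assoc_mult_mat)
  also have "\<dots> = B" using AC B by simp
  finally have "C = B" .
  with C show ?thesis by simp
qed

lemma mult_mat_vec_index_atMost:
  assumes "A \<in> carrier_mat (Suc K) (Suc K)" "v \<in> carrier_vec (Suc K)" "k \<le> K"
  shows "(A *\<^sub>v v) $ k = (\<Sum>j\<le>K. A $$ (k, j) * v $ j)"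
  using assms by (simp add: scalar_prod_def atLeast0LessThan lessThan_Suc_atMost)

lemma euclidean_norm_sq: "(euclidean_norm v)\<^sup>2 = (\<Sum>i<dim_vec v. (v $ i)\<^sup>2)"
  unfolding euclidean_norm_def L2_set_def by (simp add: sum_nonneg)

subsection \<open>Exponential moments and sample means\<close>

text \<open>Completing the square: the factor \<open>exp (c * x)\<close> shifts the mean of the
  normal density by \<open>c * \<sigma>\<^sup>2\<close> and leaves a constant, which is the moment
  generating function.\<close>

lemma has_bochner_integral_normal_exp:
  assumes "0 < \<sigma>"
  shows "has_bochner_integral lborel (\<lambda>x. normal_density \<mu> \<sigma> x * exp (c * x)) (exp (c * \<mu> + c\<^sup>2 * \<sigma>\<^sup>2 / 2))"
proof -
  have *: "normal_density \<mu> \<sigma> x * exp (c * x) =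
      exp (c * \<mu> + c\<^sup>2 * \<sigma>\<^sup>2 / 2) * normal_density (\<mu> + c * \<sigma>\<^sup>2) \<sigma> x" for x
  proof -
    have "- (x - \<mu>)\<^sup>2 / (2 * \<sigma>\<^sup>2) + c * x =
        (c * \<mu> + c\<^sup>2 * \<sigma>\<^sup>2 / 2) + - (x - (\<mu> + c * \<sigma>\<^sup>2))\<^sup>2 / (2 * \<sigma>\<^sup>2)"
      using assms by (simp add: field_simps power2_eq_square)
    then show ?thesis
      unfolding normal_density_def by (simp add: exp_add[symmetric])
  qed
  have "has_bochner_integral lborel (normal_density (\<mu> + c * \<sigma>\<^sup>2) \<sigma>) 1"
    using assms by (simp add: has_bochner_integral_iff)
  from has_bochner_integral_mult_right[OF this, of "exp (c * \<mu> + c\<^sup>2 * \<sigma>\<^sup>2 / 2)"]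
  show ?thesis by (simp add: *)
qed

text \<open>In the expanded square of the sum the off-diagonal terms vanish by independence and
  centring, and each of the \<open>N\<close> diagonal terms contributes the second moment. The left
  side is an \<open>nn_integral\<close> to match \<open>mean_square_error\<close>.\<close>

lemma nn_integral_sample_mean_square:
  fixes h :: "'c \<Rightarrow> real"
  assumes "prob_space M" and copies: "indep_copies P N Z M L X" and N: "0 < N"
    and h[measurable]: "h \<in> borel_measurable L" and X[measurable]: "X \<in> measurable M L"
    and int2: "integrable M (\<lambda>\<omega>. (h (X \<omega>))\<^sup>2)" and mean: "(\<integral>\<omega>. h (X \<omega>) \<partial>M) = 0"
  shows "(\<integral>\<^sup>+\<omega>. ennreal ((1 / real N * (\<Sum>i=1..N. h (Z i \<omega>)))\<^sup>2) \<partial>P) =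
    ennreal ((\<integral>\<omega>. (h (X \<omega>))\<^sup>2 \<partial>M) / real N)"
proof -
  interpret P: prob_space P using copies by (simp add: indep_copies_def)
  interpret prob_space M by fact
  define s where "s = (\<integral>\<omega>. (h (X \<omega>))\<^sup>2 \<partial>M)"
  define U where "U i \<omega> = h (Z i \<omega>)" for i \<omega>
  have ind: "P.indep_vars (\<lambda>_. L) Z {1..N}"
    and eq: "\<And>i. i \<in> {1..N} \<Longrightarrow> distr P L (Z i) = distr M L X"
    using copies by (auto simp: indep_copies_def)
  have Z: "Z i \<in> measurable P L" if "i \<in> {1..N}" for i
    using ind that by (auto simp: P.indep_vars_def2)
  have U: "U i \<in> borel_measurable P" if "i \<in> {1..N}" for i
    unfolding U_def using Z[OF that] by measurable
  have indU: "P.indep_vars (\<lambda>_. borel) U {1..N}"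
    unfolding U_def using P.indep_vars_compose2[OF ind, of "\<lambda>_. h" "\<lambda>_. borel"] by simp
  \<comment> \<open>The copies live on \<open>P\<close> and the model on \<open>M\<close>; equality
    of the two laws on \<open>L\<close> carries integrals from one space to the other.\<close>
  have transfer: "integrable P (\<lambda>\<omega>. g (Z i \<omega>)) = integrable M (\<lambda>\<omega>. g (X \<omega>))"
      "(\<integral>\<omega>. g (Z i \<omega>) \<partial>P) = (\<integral>\<omega>. g (X \<omega>) \<partial>M)"
    if i: "i \<in> {1..N}" and [measurable]: "g \<in> borel_measurable L" for i and g :: "'c \<Rightarrow> real"
    using integrable_distr_eq[OF Z[OF i], of g] integral_distr[OF Z[OF i], of g]
      integrable_distr_eq[OF X, of g] integral_distr[OF X, of g] eq[OF i] by auto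
  have int1: "integrable M (\<lambda>\<omega>. h (X \<omega>))"
    by (rule square_integrable_imp_integrable[OF _ int2]) measurable
  have int_U: "integrable P (U i)" "(\<integral>\<omega>. U i \<omega> \<partial>P) = 0" if "i \<in> {1..N}" for i
    using transfer[OF that h] int1 mean unfolding U_def by auto
  have prod_U: "has_bochner_integral P (\<lambda>\<omega>. U i \<omega> * U j \<omega>) (if i = j then s else 0)"
    if ij: "i \<in> {1..N}" "j \<in> {1..N}" for i j
  proof (cases "i = j")
    case True
    have "integrable P (\<lambda>\<omega>. (U j \<omega>)\<^sup>2)" "(\<integral>\<omega>. (U j \<omega>)\<^sup>2 \<partial>P) = s"
      using transfer[OF ij(2), of "\<lambda>x. (h x)\<^sup>2"] int2 unfolding U_def s_def by auto
    with True show ?thesis by (simp add: has_bochner_integral_iff power2_eq_square)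
  next
    case False
    \<comment> \<open>Pairwise independence is read off from the independence of \<open>U i\<close>
      and a sum, here over the single index \<open>j\<close>.\<close>
    have "P.indep_var borel (U i) borel (U j)"
      using P.indep_vars_sum[of "{j}" i U] P.indep_vars_subset[OF indU, of "{i, j}"] False ij by simp
    with False show ?thesis
      using P.indep_var_integrable[of "U i" "U j"] P.indep_var_lebesgue_integral[of "U i" "U j"]
        int_U[OF ij(1)] int_U[OF ij(2)]
      by (simp add: has_bochner_integral_iff)
  qed
  have "has_bochner_integral P (\<lambda>\<omega>. \<Sum>i=1..N. \<Sum>j=1..N. U i \<omega> * U j \<omega>)
      (\<Sum>i=1..N. \<Sum>j=1..N. if i = j then s else 0)"
    using prod_U by (intro has_bochner_integral_sum)
  moreover have "(\<Sum>i=1..N. \<Sum>j=1..N. if i = j then s else 0) = real N * s"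
  proof -
    have "(\<Sum>i=1..N. \<Sum>j=1..N. if i = j then s else 0) = (\<Sum>i=1..N. s)"
    proof (rule sum.cong)
      fix i assume "i \<in> {1..N}"
      then show "(\<Sum>j=1..N. if i = j then s else 0) = s"
        by (subst sum.delta') auto
    qed simp
    then show ?thesis by simp
  qed
  moreover have "(\<Sum>i=1..N. \<Sum>j=1..N. U i \<omega> * U j \<omega>) = (\<Sum>i=1..N. U i \<omega>)\<^sup>2" for \<omega>
    unfolding power2_eq_square sum_product ..
  ultimately have "has_bochner_integral P (\<lambda>\<omega>. (\<Sum>i=1..N. U i \<omega>)\<^sup>2) (real N * s)"
    by (simp only:)
  then have "has_bochner_integral P (\<lambda>\<omega>. (1 / real N)\<^sup>2 * (\<Sum>i=1..N. U i \<omega>)\<^sup>2)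
      ((1 / real N)\<^sup>2 * (real N * s))"
    by (rule has_bochner_integral_mult_right)
  moreover have "(1 / real N)\<^sup>2 * (real N * s) = s / real N"
    using N by (simp add: power2_eq_square)
  ultimately have "has_bochner_integral P (\<lambda>\<omega>. (1 / real N * (\<Sum>i=1..N. h (Z i \<omega>)))\<^sup>2) (s / real N)"
    unfolding U_def power_mult_distrib by metis
  then have *: "integrable P (\<lambda>\<omega>. (1 / real N * (\<Sum>i=1..N. h (Z i \<omega>)))\<^sup>2)"
      "(\<integral>\<omega>. (1 / real N * (\<Sum>i=1..N. h (Z i \<omega>)))\<^sup>2 \<partial>P) = s / real N"
    by (simp_all only: has_bochner_integral_iff)
  show ?thesis
    by (subst nn_integral_eq_integral[OF *(1)]) (simp_all only: *(2) s_def zero_le_power2 AE_I2)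
qed

subsection \<open>The asymptotics of the error bounds\<close>

text \<open>Expresses \<open>N\<close> through the quantity whose integer part is \<open>K\<close>,
  so that the error bounds become functions of one real variable.\<close>

lemma real_eq_exp_ln_sqrt:
  fixes \<alpha> :: real
  assumes "0 < \<alpha>" "0 < N"
  shows "real N = exp ((sqrt (\<alpha> * ln (real N)))\<^sup>2 / \<alpha>)"
proof -
  have "0 \<le> \<alpha> * ln (real N)" using assms by simp
  then show ?thesis using assms by simp
qed

text \<open>Let \<open>x\<close> be the square root before rounding. For \<open>c \<ge> 1\<close>
  and \<open>d \<ge> 0\<close> the numerator grows with \<open>K\<close>, and
  \<open>K \<le> x\<close>, so \<open>K\<close> may be replaced by \<open>x\<close>. With
  \<open>N = exp (x\<^sup>2 / \<alpha>)\<close> the exponent is then a linear term minus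
  \<open>b * x\<^sup>2\<close>, where \<open>b > 0\<close> because
  \<open>\<alpha> * d < 1\<close>.\<close>

lemma upper_bound_tendsto_0:
  fixes \<alpha> d c :: real
  assumes "0 < \<alpha>" "0 \<le> d" "\<alpha> * d < 1" "1 \<le> c"
  defines "K \<equiv> \<lambda>N. nat \<lfloor>sqrt (\<alpha> * ln (real N))\<rfloor>"
  shows "(\<lambda>N. real (Suc (K N)) ^ 4 * c ^ (2 * K N) * exp ((real (K N))\<^sup>2 * d) / real N) \<longlonglongrightarrow> 0"
proof -
  define x where "x N = sqrt (\<alpha> * ln (real N))" for N :: nat
  define b where "b = 1 / \<alpha> - d"
  define f where "f y = (y + 1) ^ 4 * exp (2 * ln c * y - b * y\<^sup>2)" for y :: real
  have b: "0 < b" using assms by (simp add: b_def field_simps)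
  have "(f \<longlongrightarrow> 0) at_top"
    unfolding f_def using b by real_asymp
  moreover have "filterlim x at_top sequentially"
    unfolding x_def using assms(1) by real_asymp
  ultimately have lim: "(\<lambda>N. f (x N)) \<longlonglongrightarrow> 0"
    by (rule filterlim_compose)
  have bound: "real (Suc (K N)) ^ 4 * c ^ (2 * K N) * exp ((real (K N))\<^sup>2 * d) / real N \<le> f (x N)"
    if N: "0 < N" for N
  proof -
    have x: "0 \<le> x N" using assms(1) N by (simp add: x_def)
    then have K: "real (K N) \<le> x N" unfolding K_def x_def by linarith
    have RN: "real N = exp ((x N)\<^sup>2 / \<alpha>)"
      unfolding x_def by (rule real_eq_exp_ln_sqrt[OF assms(1) N])
    have "real (Suc (K N)) ^ 4 * c ^ (2 * K N) * exp ((real (K N))\<^sup>2 * d) / real N \<le>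
        (x N + 1) ^ 4 * exp (2 * ln c * x N) * exp ((x N)\<^sup>2 * d) / real N"
    proof (intro divide_right_mono mult_mono)
      show "real (Suc (K N)) ^ 4 \<le> (x N + 1) ^ 4"
        using K by (intro power_mono) auto
      have "c ^ (2 * K N) = exp (real (2 * K N) * ln c)"
        using assms(4) by (subst exp_of_nat_mult) simp
      also have "\<dots> \<le> exp (2 * ln c * x N)"
        using mult_left_mono[OF K, of "2 * ln c"] assms(4) by (simp add: mult_ac)
      finally show "c ^ (2 * K N) \<le> exp (2 * ln c * x N)" .
      show "exp ((real (K N))\<^sup>2 * d) \<le> exp ((x N)\<^sup>2 * d)"
        using K assms(2) by (simp add: mult_right_mono power_mono)
    qed (use x assms(4) in auto)
    also have "\<dots> = f (x N)"
    proof -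
      have "exp (2 * ln c * x N) * exp ((x N)\<^sup>2 * d) / real N = exp (2 * ln c * x N - b * (x N)\<^sup>2)"
        unfolding RN exp_add[symmetric] exp_diff[symmetric] b_def
        by (rule arg_cong[where f = exp]) (simp add: left_diff_distrib)
      then show ?thesis by (simp only: f_def mult.assoc times_divide_eq_right[symmetric])
    qed
    finally show ?thesis .
  qed
  have "eventually (\<lambda>N. real (Suc (K N)) ^ 4 * c ^ (2 * K N) * exp ((real (K N))\<^sup>2 * d) / real N
      \<le> f (x N)) sequentially"
    using eventually_gt_at_top[of "0::nat"] by eventually_elim (rule bound)
  moreover have "0 \<le> real (Suc (K N)) ^ 4 * c ^ (2 * K N) * exp ((real (K N))\<^sup>2 * d) / real N" for N
    using assms(4) by (intro divide_nonneg_nonneg mult_nonneg_nonneg) simp_all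
  ultimately show ?thesis
    using lim by (intro tendsto_sandwich[OF always_eventually _ tendsto_const lim]) blast+
qed

text \<open>Rounding down costs at most one, so \<open>K\<close> is replaced by
  \<open>x - 1\<close>. This changes the exponent \<open>d * x\<^sup>2\<close> only by a linear
  term, which cannot offset the surplus \<open>d - 1 / \<alpha> > 0\<close> in the quadratic
  one.\<close>

lemma lower_bound_at_top:
  fixes \<alpha> d :: real
  assumes "0 < \<alpha>" "1 < \<alpha> * d"
  defines "K \<equiv> \<lambda>N. nat \<lfloor>sqrt (\<alpha> * ln (real N))\<rfloor>"
  shows "filterlim (\<lambda>N. (exp ((real (K N))\<^sup>2 * d) / real (Suc (K N)) - 1) / real N) at_top sequentially"
proof -
  define x where "x N = sqrt (\<alpha> * ln (real N))" for N :: nat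
  \<comment> \<open>With this \<open>e\<close>, \<open>exp (- e * (x N)\<^sup>2)\<close> equals
    \<open>1 / real N\<close>, so the first summand of \<open>f\<close> is the contribution of the
    \<open>- 1\<close> in the bound.\<close>
  define e where "e = 1 / \<alpha>"
  define b where "b = d - e"
  define f where "f y = - exp (- e * y\<^sup>2) + exp (b * y\<^sup>2 - 2 * d * y + d) / (y + 1)" for y :: real
  have b: "0 < b" "0 < e" "0 < d" 
    using assms(1,2) zero_less_mult_pos[of \<alpha> d] by (auto simp: b_def e_def field_simps)
  have 1: "filterlim (\<lambda>y. exp (b * y\<^sup>2 - 2 * d * y + d) / (y + 1)) at_top at_top"
    using b(1,3) by real_asymp
  have 2: "((\<lambda>y. - exp (- e * y\<^sup>2)) \<longlongrightarrow> 0) at_top"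
    using b(2) by real_asymp
  have "filterlim f at_top at_top"
    unfolding f_def by (rule filterlim_tendsto_add_at_top[OF 2 1])
  moreover have x_lim: "filterlim x at_top sequentially"
    unfolding x_def using assms(1) by real_asymp
  ultimately have lim: "filterlim (\<lambda>N. f (x N)) at_top sequentially"
    by (rule filterlim_compose)
  have bound: "f (x N) \<le> (exp ((real (K N))\<^sup>2 * d) / real (Suc (K N)) - 1) / real N"
    if N: "0 < N" and x: "1 \<le> x N" for N
  proof -
    have K: "real (K N) \<le> x N" "x N - 1 \<le> real (K N)"
      using x unfolding K_def x_def by linarith+
    have RN: "real N = exp ((x N)\<^sup>2 / \<alpha>)"
      unfolding x_def by (rule real_eq_exp_ln_sqrt[OF assms(1) N])
    have "exp (b * (x N)\<^sup>2 - 2 * d * x N + d) = exp ((x N - 1)\<^sup>2 * d) / real N"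
      unfolding RN exp_diff[symmetric] b_def e_def
      by (rule arg_cong[where f = exp]) (simp add: power2_eq_square algebra_simps)
    moreover have "exp (- e * (x N)\<^sup>2) = 1 / real N"
      unfolding RN e_def by (simp add: exp_minus inverse_eq_divide)
    ultimately have "f (x N) = (exp ((x N - 1)\<^sup>2 * d) / (x N + 1) - 1) / real N"
      unfolding f_def by (simp add: diff_divide_distrib)
    also have "\<dots> \<le> (exp ((real (K N))\<^sup>2 * d) / real (Suc (K N)) - 1) / real N"
    proof (intro divide_right_mono diff_right_mono frac_le)
      \<comment> \<open>Squaring preserves the order because \<open>1 \<le> x N\<close>.\<close>
      show "exp ((x N - 1)\<^sup>2 * d) \<le> exp ((real (K N))\<^sup>2 * d)"
        using K x b(3) by (simp add: power_mono)
    qed (use K in auto)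
    finally show ?thesis .
  qed
  have "eventually (\<lambda>N. f (x N) \<le> (exp ((real (K N))\<^sup>2 * d) / real (Suc (K N)) - 1) / real N) sequentially"
    using eventually_gt_at_top[of "0::nat"] filterlim_at_top[THEN iffD1, OF x_lim, rule_format, of 1]
    by eventually_elim (rule bound)
  with lim show ?thesis by (rule filterlim_at_top_mono)
qed

subsection \<open>The mean square error of the regression estimator\<close>

locale bm_regression =
  fixes M :: "'a measure" and W :: "real \<Rightarrow> 'a \<Rightarrow> real" and t\<^sub>1 t\<^sub>2 :: real
  assumes t1_pos: "0 < t\<^sub>1" and t1_less: "t\<^sub>1 < t\<^sub>2"
    and bm: "standard_brownian_motion M W"
begin

sublocale prob_space M
  using bm by (simp add: standard_brownian_motion_def)

section \<open>Joint exponential moments at the two dates\<close>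

abbreviation S :: "real \<Rightarrow> 'a \<Rightarrow> real" where "S \<equiv> geometric_bm W"

lemma measurable_W: "0 \<le> t \<Longrightarrow> W t \<in> borel_measurable M"
  using bm by (simp add: standard_brownian_motion_def)

lemma measurable_W12 [measurable]: "W t\<^sub>1 \<in> borel_measurable M" "W t\<^sub>2 \<in> borel_measurable M"
  using measurable_W t1_pos t1_less by auto

lemma has_bochner_integral_exp_increment:
  assumes "0 \<le> s" "s < t"
  shows "has_bochner_integral M (\<lambda>\<omega>. exp (c * (W t \<omega> - W s \<omega>))) (exp (c\<^sup>2 * (t - s) / 2))"
proof -
  let ?f = "normal_density 0 (sqrt (t - s))"
  have D: "distributed M lborel (\<lambda>\<omega>. W t \<omega> - W s \<omega>) ?f"
    using bm assms by (simp add: standard_brownian_motion_def)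
  have "has_bochner_integral lborel (\<lambda>x. ?f x * exp (c * x)) (exp (c\<^sup>2 * (t - s) / 2))"
    using has_bochner_integral_normal_exp[of "sqrt (t - s)" 0 c] assms by simp
  then show ?thesis
    using distributed_integrable[OF D, of "\<lambda>x. exp (c * x)"]
      distributed_integral[OF D, of "\<lambda>x. exp (c * x)"]
    by (simp add: has_bochner_integral_iff)
qed

text \<open>Almost surely the exponent is \<open>(c + d) * (W t\<^sub>1 - W 0) + d * (W t\<^sub>2 -
  W t\<^sub>1)\<close>, a combination of independent normal increments, so the expectation is a
  product of two moment generating functions.\<close>

lemma has_bochner_integral_exp_W12:
  "has_bochner_integral M (\<lambda>\<omega>. exp (c * W t\<^sub>1 \<omega> + d * W t\<^sub>2 \<omega>))
     (exp ((c\<^sup>2 * t\<^sub>1 + d\<^sup>2 * t\<^sub>2) / 2 + c * d * t\<^sub>1))"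
proof -
  define \<tau> where "\<tau> i = (if i = 0 then 0 else if i = 1 then t\<^sub>1 else t\<^sub>2)" for i :: nat
  define e where "e i = (if i = 0 then c + d else d)" for i :: nat
  define X where "X i \<omega> = exp (e i * (W (\<tau> (Suc i)) \<omega> - W (\<tau> i) \<omega>))" for i \<omega>
  have "\<forall>i<2. \<tau> i \<le> \<tau> (Suc i)"
    using t1_pos t1_less by (simp add: \<tau>_def)
  moreover have "0 \<le> \<tau> 0" by (simp add: \<tau>_def)
  ultimately have "indep_vars (\<lambda>_. borel) (\<lambda>i \<omega>. W (\<tau> (Suc i)) \<omega> - W (\<tau> i) \<omega>) {..<2}"
    using bm unfolding standard_brownian_motion_def by blast
  from indep_vars_compose2[OF this, of "\<lambda>i x. exp (e i * x)" "\<lambda>_. borel"]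
  have ind: "indep_vars (\<lambda>_. borel) X {..<2}"
    unfolding X_def by simp
  have X: "has_bochner_integral M (X i) (exp ((e i)\<^sup>2 * (\<tau> (Suc i) - \<tau> i) / 2))" if "i < 2" for i
    unfolding X_def using that t1_pos t1_less
    by (intro has_bochner_integral_exp_increment) (auto simp: \<tau>_def)
  have "has_bochner_integral M (\<lambda>\<omega>. \<Prod>i<2. X i \<omega>) (\<Prod>i<2. exp ((e i)\<^sup>2 * (\<tau> (Suc i) - \<tau> i) / 2))"
    using indep_vars_integrable[OF _ ind] indep_vars_lebesgue_integral[OF _ ind] X
    by (simp add: has_bochner_integral_iff)
  moreover have "(\<Prod>i<2. exp ((e i)\<^sup>2 * (\<tau> (Suc i) - \<tau> i) / 2)) =
      exp ((c\<^sup>2 * t\<^sub>1 + d\<^sup>2 * t\<^sub>2) / 2 + c * d * t\<^sub>1)"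
    by (simp add: numeral_2_eq_2 e_def \<tau>_def exp_add[symmetric] power2_eq_square field_simps)
  ultimately have *: "has_bochner_integral M (\<lambda>\<omega>. \<Prod>i<2. X i \<omega>)
      (exp ((c\<^sup>2 * t\<^sub>1 + d\<^sup>2 * t\<^sub>2) / 2 + c * d * t\<^sub>1))"
    by simp
  \<comment> \<open>The start at 0 is only almost sure, so the integrands are exchanged almost
    everywhere.\<close>
  have "AE \<omega> in M. W 0 \<omega> = 0"
    using bm by (simp add: standard_brownian_motion_def)
  then have "AE \<omega> in M. (\<Prod>i<2. X i \<omega>) = exp (c * W t\<^sub>1 \<omega> + d * W t\<^sub>2 \<omega>)"
    by eventually_elim
      (simp add: numeral_2_eq_2 X_def e_def \<tau>_def exp_add[symmetric] algebra_simps)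
  moreover have "(\<lambda>\<omega>. \<Prod>i<2. X i \<omega>) \<in> borel_measurable M"
    using * by (simp add: has_bochner_integral_iff borel_measurable_integrable)
  ultimately show ?thesis
    using * by (subst has_bochner_integral_cong_AE[symmetric]) auto
qed

text \<open>The single source of all moments below. As \<open>psi t 0 = 1\<close>, zero indices give
  the Gram entries and the cross moments; equal indices give the second moments of products. The
  normalisation of \<open>psi\<close> cancels the pure squares in the exponent, leaving mixed
  products of indices.\<close>

lemma has_bochner_integral_psi_products:
  "has_bochner_integral M
     (\<lambda>\<omega>. psi t\<^sub>2 m (S t\<^sub>2 \<omega>) * psi t\<^sub>2 m' (S t\<^sub>2 \<omega>) * (psi t\<^sub>1 k (S t\<^sub>1 \<omega>) * psi t\<^sub>1 k' (S t\<^sub>1 \<omega>)))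
     (exp (real m * real m' * t\<^sub>2 + real k * real k' * t\<^sub>1 + (real m + real m') * (real k + real k') * t\<^sub>1))"
proof -
  let ?c = "real k + real k'" and ?d = "real m + real m'"
  \<comment> \<open>The deterministic normalising exponents of the four factors.\<close>
  let ?r = "- ((real m)\<^sup>2 + (real m')\<^sup>2) * t\<^sub>2 / 2 - ((real k)\<^sup>2 + (real k')\<^sup>2) * t\<^sub>1 / 2"
  have 1: "psi t\<^sub>2 m (S t\<^sub>2 \<omega>) * psi t\<^sub>2 m' (S t\<^sub>2 \<omega>) * (psi t\<^sub>1 k (S t\<^sub>1 \<omega>) * psi t\<^sub>1 k' (S t\<^sub>1 \<omega>)) =
      exp ?r * exp (?c * W t\<^sub>1 \<omega> + ?d * W t\<^sub>2 \<omega>)" for \<omega>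
    unfolding psi_geometric_bm exp_add[symmetric]
    by (rule arg_cong[where f = exp]) (simp add: field_simps)
  have 2: "exp ?r * exp ((?c\<^sup>2 * t\<^sub>1 + ?d\<^sup>2 * t\<^sub>2) / 2 + ?c * ?d * t\<^sub>1) =
      exp (real m * real m' * t\<^sub>2 + real k * real k' * t\<^sub>1 + ?d * ?c * t\<^sub>1)"
    unfolding exp_add[symmetric]
    by (rule arg_cong[where f = exp]) (simp add: power2_eq_square field_simps)
  show ?thesis
    unfolding 1 2[symmetric] by (intro has_bochner_integral_mult_right has_bochner_integral_exp_W12)
qed

lemma psi_0 [simp]: "psi t 0 x = 1"
  by (simp add: psi_def)

lemma psi_measurable [measurable]: "psi t k \<in> borel_measurable borel"
  unfolding psi_def by measurable

lemma measurable_S [measurable]: "S t\<^sub>1 \<in> borel_measurable M" "S t\<^sub>2 \<in> borel_measurable M"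
  unfolding geometric_bm_def by measurable

lemma payoff_measurable [measurable]: "payoff W t\<^sub>2 K a \<in> borel_measurable M"
  unfolding payoff_def by measurable

section \<open>The Gram matrix and the regression coefficients\<close>

text \<open>Written in Vandermonde form with nodes \<open>exp t\<^sub>1 ^ i\<close>, so that the
  explicit inverse for geometric nodes applies with \<open>q = exp t\<^sub>1\<close>.\<close>

definition gram :: "nat \<Rightarrow> real mat" where
  "gram K = mat (Suc K) (Suc K) (\<lambda>(i, k). (exp t\<^sub>1 ^ i) ^ k)"

lemma gram_carrier [simp]: "gram K \<in> carrier_mat (Suc K) (Suc K)"
  by (simp add: gram_def)

lemma gram_index: "i \<le> K \<Longrightarrow> k \<le> K \<Longrightarrow> gram K $$ (i, k) = exp (real i * real k * t\<^sub>1)"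
  by (simp add: gram_def power_mult[symmetric] exp_of_nat_mult[symmetric])

lemma gram_matrix_eq: "gram_matrix M K (psi t\<^sub>1) (S t\<^sub>1) = gram K"
proof (rule eq_matI)
  fix i k assume "i < dim_row (gram K)" "k < dim_col (gram K)"
  then have "i \<le> K" "k \<le> K" by (simp_all add: gram_def)
  then show "gram_matrix M K (psi t\<^sub>1) (S t\<^sub>1) $$ (i, k) = gram K $$ (i, k)"
    using has_bochner_integral_psi_products[of 0 0 i k]
    by (simp add: gram_matrix_def gram_index has_bochner_integral_iff)
qed (simp_all add: gram_matrix_def gram_def)

text \<open>The expectation of \<open>psi t\<^sub>2 m (S t\<^sub>2) * psi t\<^sub>1 k (S
  t\<^sub>1)\<close> is \<open>exp (m * k * t\<^sub>1)\<close>, free of \<open>t\<^sub>2\<close>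
  because the exponentials are martingales. It is the Gram entry, so the payoff acts through
  \<open>gram K\<close> on its coefficients.\<close>

lemma has_bochner_integral_payoff_psi:
  assumes "a \<in> carrier_vec (Suc K)" "k \<le> K"
  shows "has_bochner_integral M (\<lambda>\<omega>. payoff W t\<^sub>2 K a \<omega> * psi t\<^sub>1 k (S t\<^sub>1 \<omega>)) ((gram K *\<^sub>v a) $ k)"
proof -
  have "has_bochner_integral M (\<lambda>\<omega>. \<Sum>m\<le>K. a $ m * (psi t\<^sub>2 m (S t\<^sub>2 \<omega>) * psi t\<^sub>1 k (S t\<^sub>1 \<omega>)))
      (\<Sum>m\<le>K. a $ m * exp (real m * real k * t\<^sub>1))"
    using has_bochner_integral_psi_products[of _ 0 k 0]
    by (intro has_bochner_integral_sum has_bochner_integral_mult_right) simp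
  moreover have "(\<Sum>m\<le>K. a $ m * (psi t\<^sub>2 m (S t\<^sub>2 \<omega>) * psi t\<^sub>1 k (S t\<^sub>1 \<omega>))) =
      payoff W t\<^sub>2 K a \<omega> * psi t\<^sub>1 k (S t\<^sub>1 \<omega>)" for \<omega>
    by (simp add: payoff_def sum_distrib_right mult.assoc)
  moreover have "(\<Sum>m\<le>K. a $ m * exp (real m * real k * t\<^sub>1)) = (gram K *\<^sub>v a) $ k"
  proof -
    have "(gram K *\<^sub>v a) $ k = (\<Sum>m<Suc K. gram K $$ (k, m) * a $ m)"
      using assms by (simp add: scalar_prod_def gram_def atLeast0LessThan del: sum.lessThan_Suc)
    also have "\<dots> = (\<Sum>m\<le>K. a $ m * exp (real m * real k * t\<^sub>1))"
      using assms(2) unfolding lessThan_Suc_atMost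
      by (intro sum.cong) (simp_all add: gram_index mult_ac)
    finally show ?thesis by simp
  qed
  ultimately show ?thesis by simp
qed

lemma cross_moments_eq:
  assumes "a \<in> carrier_vec (Suc K)"
  shows "cross_moments M K (psi t\<^sub>1) (S t\<^sub>1) (payoff W t\<^sub>2 K a) = gram K *\<^sub>v a"
proof (rule eq_vecI)
  fix k assume "k < dim_vec (gram K *\<^sub>v a)"
  then have "k \<le> K" by (simp add: gram_def)
  with has_bochner_integral_payoff_psi[OF assms this]
  show "cross_moments M K (psi t\<^sub>1) (S t\<^sub>1) (payoff W t\<^sub>2 K a) $ k = (gram K *\<^sub>v a) $ k"
    by (simp add: cross_moments_def has_bochner_integral_iff)
qed (simp add: cross_moments_def gram_def)

definition gram_inv :: "nat \<Rightarrow> real mat" where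
  "gram_inv K = the (mat_inverse (gram K))"

text \<open>The Lagrange right inverse is the matrix that \<open>mat_inverse\<close> returns, so its
  entry bound passes to \<open>gram_inv\<close>.\<close>

lemma gram_inv:
  shows gram_inv_carrier [simp]: "gram_inv K \<in> carrier_mat (Suc K) (Suc K)"
    and gram_gram_inv: "gram K * gram_inv K = 1\<^sub>m (Suc K)"
    and gram_inv_gram: "gram_inv K * gram K = 1\<^sub>m (Suc K)"
    and abs_gram_inv_le:
      "k \<le> K \<Longrightarrow> j \<le> K \<Longrightarrow> \<bar>gram_inv K $$ (k, j)\<bar> \<le> ((exp t\<^sub>1 + 1) / (exp t\<^sub>1 - 1)) ^ K"
proof -
  have "1 < exp t\<^sub>1" using t1_pos by simp
  then obtain B where B: "B \<in> carrier_mat (Suc K) (Suc K)" "gram K * B = 1\<^sub>m (Suc K)"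
      "\<And>k j. k \<le> K \<Longrightarrow> j \<le> K \<Longrightarrow> \<bar>B $$ (k, j)\<bar> \<le> ((exp t\<^sub>1 + 1) / (exp t\<^sub>1 - 1)) ^ K"
    using geometric_vandermonde_right_inverse[of "exp t\<^sub>1" K] unfolding gram_def by metis
  have "gram_inv K = B"
    unfolding gram_inv_def using B by (intro the_mat_inverse_eqI) auto
  with B show "gram_inv K \<in> carrier_mat (Suc K) (Suc K)" "gram K * gram_inv K = 1\<^sub>m (Suc K)"
    "gram_inv K * gram K = 1\<^sub>m (Suc K)"
    "k \<le> K \<Longrightarrow> j \<le> K \<Longrightarrow> \<bar>gram_inv K $$ (k, j)\<bar> \<le> ((exp t\<^sub>1 + 1) / (exp t\<^sub>1 - 1)) ^ K"
    using mat_mult_left_right_inverse[OF gram_carrier B(1,2)] by auto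
qed

lemma gram_inv_mult_vec_gram: "a \<in> carrier_vec (Suc K) \<Longrightarrow> gram_inv K *\<^sub>v (gram K *\<^sub>v a) = a"
  using assoc_mult_mat_vec[OF gram_inv_carrier gram_carrier, of a K] by (simp add: gram_inv_gram)

text \<open>The cross moments are \<open>gram K *\<^sub>v a\<close>, and the inverse undoes the
  product. The constraint on the norm of the coefficient vector thus becomes one on \<open>a\<close>
  itself.\<close>

lemma bm_coeff_eq: "a \<in> carrier_vec (Suc K) \<Longrightarrow> bm_coeff M W t\<^sub>1 t\<^sub>2 K a = a"
  unfolding bm_coeff_def regression_coeff_def gram_matrix_eq gram_inv_def[symmetric]
  by (simp add: cross_moments_eq gram_inv_mult_vec_gram)

section \<open>The dual basis\<close>

text \<open>The basis biorthogonal to \<open>psi t\<^sub>1\<close> under the law of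
  \<open>S t\<^sub>1\<close>: coordinate \<open>k\<close> of the estimator is the sample mean of the
  payoff times \<open>dual_psi K k\<close>.\<close>

definition dual_psi :: "nat \<Rightarrow> nat \<Rightarrow> real \<Rightarrow> real" where
  "dual_psi K k x = (\<Sum>j\<le>K. gram_inv K $$ (k, j) * psi t\<^sub>1 j x)"

lemma dual_psi_measurable [measurable]: "dual_psi K k \<in> borel_measurable borel"
  unfolding dual_psi_def by measurable

text \<open>The inverse relation, from \<open>gram K * gram_inv K = 1\<^sub>m (Suc K)\<close>. It
  serves to bound the dual functions from below.\<close>

lemma psi_eq_sum_dual_psi:
  assumes "k \<le> K"
  shows "psi t\<^sub>1 k x = (\<Sum>j\<le>K. gram K $$ (k, j) * dual_psi K j x)"
proof -
  define v where "v = vec (Suc K) (\<lambda>j. psi t\<^sub>1 j x)"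
  have v: "v \<in> carrier_vec (Suc K)" by (simp add: v_def)
  have Bv: "(gram_inv K *\<^sub>v v) $ j = dual_psi K j x" if "j \<le> K" for j
    unfolding dual_psi_def mult_mat_vec_index_atMost[OF gram_inv_carrier v that]
    by (simp add: v_def)
  have "gram K *\<^sub>v (gram_inv K *\<^sub>v v) = v"
    using assoc_mult_mat_vec[OF gram_carrier gram_inv_carrier v] v by (simp add: gram_gram_inv)
  then have "psi t\<^sub>1 k x = (gram K *\<^sub>v (gram_inv K *\<^sub>v v)) $ k"
    using assms by (simp add: v_def)
  also have "\<dots> = (\<Sum>j\<le>K. gram K $$ (k, j) * dual_psi K j x)"
    using assms v mult_mat_vec_carrier[OF gram_inv_carrier v]
    by (simp add: mult_mat_vec_index_atMost[OF gram_carrier] Bv del: index_mult_mat_vec)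
  finally show ?thesis .
qed

text \<open>By linearity the expectation is entry \<open>k\<close> of the inverse applied to
  \<open>gram K *\<^sub>v a\<close>. This makes the estimator unbiased.\<close>

lemma expectation_payoff_dual_psi:
  assumes a: "a \<in> carrier_vec (Suc K)" and k: "k \<le> K"
  shows "expectation (\<lambda>\<omega>. payoff W t\<^sub>2 K a \<omega> * dual_psi K k (S t\<^sub>1 \<omega>)) = a $ k"
proof -
  have "has_bochner_integral M
      (\<lambda>\<omega>. \<Sum>j\<le>K. gram_inv K $$ (k, j) * (payoff W t\<^sub>2 K a \<omega> * psi t\<^sub>1 j (S t\<^sub>1 \<omega>)))
      (\<Sum>j\<le>K. gram_inv K $$ (k, j) * (gram K *\<^sub>v a) $ j)"
    by (intro has_bochner_integral_sum has_bochner_integral_mult_right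
        has_bochner_integral_payoff_psi[OF a]) simp
  moreover have "(\<Sum>j\<le>K. gram_inv K $$ (k, j) * (gram K *\<^sub>v a) $ j) = a $ k"
    using mult_mat_vec_index_atMost[OF gram_inv_carrier mult_mat_vec_carrier[OF gram_carrier a] k]
    by (simp add: gram_inv_mult_vec_gram a)
  moreover have "(\<Sum>j\<le>K. gram_inv K $$ (k, j) * (payoff W t\<^sub>2 K a \<omega> * psi t\<^sub>1 j (S t\<^sub>1 \<omega>))) =
      payoff W t\<^sub>2 K a \<omega> * dual_psi K k (S t\<^sub>1 \<omega>)" for \<omega>
    by (simp add: dual_psi_def sum_distrib_left mult_ac)
  ultimately show ?thesis by (simp add: has_bochner_integral_iff)
qed

text \<open>The square expands into a finite combination of fourfold products of basis functions,
  each of them integrable.\<close>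

lemma integrable_payoff_dual_psi_sq:
  "integrable M (\<lambda>\<omega>. (payoff W t\<^sub>2 K a \<omega> * dual_psi K k (S t\<^sub>1 \<omega>))\<^sup>2)"
proof -
  define B where "B j = gram_inv K $$ (k, j)" for j
  have "integrable M (\<lambda>\<omega>. \<Sum>m\<le>K. \<Sum>m'\<le>K. \<Sum>j\<le>K. \<Sum>j'\<le>K. a $ m * a $ m' * (B j * B j') *
      (psi t\<^sub>2 m (S t\<^sub>2 \<omega>) * psi t\<^sub>2 m' (S t\<^sub>2 \<omega>) * (psi t\<^sub>1 j (S t\<^sub>1 \<omega>) * psi t\<^sub>1 j' (S t\<^sub>1 \<omega>))))"
    using has_bochner_integral_psi_products
    by (intro Bochner_Integration.integrable_sum integrable_mult_right)
      (simp add: has_bochner_integral_iff)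
  moreover have "(payoff W t\<^sub>2 K a \<omega> * dual_psi K k (S t\<^sub>1 \<omega>))\<^sup>2 =
      (\<Sum>m\<le>K. \<Sum>m'\<le>K. \<Sum>j\<le>K. \<Sum>j'\<le>K. a $ m * a $ m' * (B j * B j') *
      (psi t\<^sub>2 m (S t\<^sub>2 \<omega>) * psi t\<^sub>2 m' (S t\<^sub>2 \<omega>) * (psi t\<^sub>1 j (S t\<^sub>1 \<omega>) * psi t\<^sub>1 j' (S t\<^sub>1 \<omega>))))" for \<omega>
    unfolding payoff_def dual_psi_def B_def power2_eq_square sum_product by (simp add: mult_ac)
  ultimately show ?thesis by simp
qed

section \<open>The exact mean square error\<close>

text \<open>In each coordinate the error is the sample mean of independent centred variables, so its
  mean square is the variance of payoff times dual function, divided by \<open>N\<close>; the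
  coordinates add up.\<close>

lemma mean_square_error_eq:
  assumes a: "a \<in> carrier_vec (Suc K)" and N: "0 < N"
    and copies: "indep_copies P N Z M (borel \<Otimes>\<^sub>M borel) (\<lambda>\<omega>. (S t\<^sub>1 \<omega>, payoff W t\<^sub>2 K a \<omega>))"
  shows "mean_square_error P (regression_estimator M K (psi t\<^sub>1) (S t\<^sub>1) N Z) a =
    ennreal ((\<Sum>k\<le>K. expectation (\<lambda>\<omega>. (payoff W t\<^sub>2 K a \<omega> * dual_psi K k (S t\<^sub>1 \<omega>))\<^sup>2) - (a $ k)\<^sup>2) / real N)"
proof -
  \<comment> \<open>A function of the observed pair alone, so that it applies to the model and to
    every copy.\<close>
  define h where "h k z = snd z * dual_psi K k (fst z) - a $ k" for k and z :: "real \<times> real"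
  define G where "G k \<omega> = payoff W t\<^sub>2 K a \<omega> * dual_psi K k (S t\<^sub>1 \<omega>)" for k \<omega>
  let ?X = "\<lambda>\<omega>. (S t\<^sub>1 \<omega>, payoff W t\<^sub>2 K a \<omega>)"
  interpret P: prob_space P using copies by (simp add: indep_copies_def)
  have h [measurable]: "h k \<in> borel_measurable (borel \<Otimes>\<^sub>M borel)" for k
    unfolding h_def by measurable
  have Z: "Z i \<in> measurable P (borel \<Otimes>\<^sub>M borel)" if "i \<in> {1..N}" for i
    using copies that by (auto simp: indep_copies_def P.indep_vars_def2)
  have hZ: "(\<lambda>\<omega>. h k (Z i \<omega>)) \<in> borel_measurable P" if "i \<in> {1..N}" for i k
    using measurable_compose[OF Z[OF that] h] .
  have G: "integrable M (\<lambda>\<omega>. (G k \<omega>)\<^sup>2)" "integrable M (G k)" for k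
  proof -
    show 1: "integrable M (\<lambda>\<omega>. (G k \<omega>)\<^sup>2)"
      unfolding G_def by (rule integrable_payoff_dual_psi_sq)
    show "integrable M (G k)"
      by (rule square_integrable_imp_integrable[OF _ 1]) (simp add: G_def)
  qed
  have EG: "expectation (G k) = a $ k" if "k \<le> K" for k
    unfolding G_def by (rule expectation_payoff_dual_psi[OF a that])
  have hX: "h k (?X \<omega>) = G k \<omega> - a $ k" for k \<omega>
    by (simp add: h_def G_def)
  \<comment> \<open>As \<open>a $ k\<close> is the mean of \<open>G k\<close>, this value is the
    variance of \<open>G k\<close>.\<close>
  have hX2: "has_bochner_integral M (\<lambda>\<omega>. (h k (?X \<omega>))\<^sup>2) (expectation (\<lambda>\<omega>. (G k \<omega>)\<^sup>2) - (a $ k)\<^sup>2)"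
    if "k \<le> K" for k
    using G[of k] EG[OF that]
    by (simp add: hX has_bochner_integral_iff power2_diff prob_space power2_eq_square[of "a $ k"])
  have coord: "regression_estimator M K (psi t\<^sub>1) (S t\<^sub>1) N Z \<omega> $ k - a $ k =
      1 / real N * (\<Sum>i=1..N. h k (Z i \<omega>))" if k: "k \<le> K" for k \<omega>
  proof -
    define e where "e = empirical_cross_moments K (psi t\<^sub>1) N Z \<omega>"
    have e: "e \<in> carrier_vec (Suc K)" by (simp add: e_def empirical_cross_moments_def)
    have "regression_estimator M K (psi t\<^sub>1) (S t\<^sub>1) N Z \<omega> $ k - a $ k = (gram_inv K *\<^sub>v e) $ k - a $ k"
      unfolding regression_estimator_def gram_matrix_eq gram_inv_def[symmetric] e_def ..
    also have "(gram_inv K *\<^sub>v e) $ k = (\<Sum>j\<le>K. gram_inv K $$ (k, j) * e $ j)"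
      by (rule mult_mat_vec_index_atMost[OF gram_inv_carrier e k])
    also have "\<dots> = (\<Sum>j\<le>K. \<Sum>i=1..N. 1 / real N * (snd (Z i \<omega>) * (gram_inv K $$ (k, j) * psi t\<^sub>1 j (fst (Z i \<omega>)))))"
      by (intro sum.cong)
        (simp_all add: e_def empirical_cross_moments_def sum_distrib_left mult_ac)
    also have "\<dots> = (\<Sum>i=1..N. 1 / real N * (snd (Z i \<omega>) * dual_psi K k (fst (Z i \<omega>))))"
      by (subst sum.swap) (simp add: dual_psi_def sum_distrib_left)
    \<comment> \<open>The constant \<open>a $ k\<close> is the mean of \<open>N\<close> copies of
      itself, hence moves into the sum for \<open>N > 0\<close>.\<close>
    also have "\<dots> - a $ k = 1 / real N * (\<Sum>i=1..N. h k (Z i \<omega>))"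
      using N by (simp add: h_def sum_subtractf sum_distrib_left right_diff_distrib)
    finally show ?thesis .
  qed
  have "(euclidean_norm (regression_estimator M K (psi t\<^sub>1) (S t\<^sub>1) N Z \<omega> - a))\<^sup>2 =
      (\<Sum>k\<le>K. (1 / real N * (\<Sum>i=1..N. h k (Z i \<omega>)))\<^sup>2)" for \<omega>
    unfolding euclidean_norm_sq using a by (intro sum.cong) (auto simp: coord)
  then have "mean_square_error P (regression_estimator M K (psi t\<^sub>1) (S t\<^sub>1) N Z) a =
      (\<integral>\<^sup>+\<omega>. (\<Sum>k\<le>K. ennreal ((1 / real N * (\<Sum>i=1..N. h k (Z i \<omega>)))\<^sup>2)) \<partial>P)"
    unfolding mean_square_error_def by (simp del: sum_ennreal add: sum_ennreal[symmetric])
  also have "\<dots> = (\<Sum>k\<le>K. \<integral>\<^sup>+\<omega>. ennreal ((1 / real N * (\<Sum>i=1..N. h k (Z i \<omega>)))\<^sup>2) \<partial>P)"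
    by (intro nn_integral_sum measurable_compose[OF _ measurable_ennreal] borel_measurable_power
        borel_measurable_times borel_measurable_const borel_measurable_sum hZ)
  also have "\<dots> = (\<Sum>k\<le>K. ennreal ((expectation (\<lambda>\<omega>. (G k \<omega>)\<^sup>2) - (a $ k)\<^sup>2) / real N))"
  proof (intro sum.cong refl)
    fix k assume "k \<in> {..K}"
    then have k: "k \<le> K" by simp
    have "expectation (\<lambda>\<omega>. h k (?X \<omega>)) = 0"
      using G(2)[of k] EG[OF k] by (simp add: hX prob_space)
    with nn_integral_sample_mean_square[OF prob_space_axioms copies N h] hX2[OF k]
    show "(\<integral>\<^sup>+\<omega>. ennreal ((1 / real N * (\<Sum>i=1..N. h k (Z i \<omega>)))\<^sup>2) \<partial>P) =
        ennreal ((expectation (\<lambda>\<omega>. (G k \<omega>)\<^sup>2) - (a $ k)\<^sup>2) / real N)"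
      by (simp add: has_bochner_integral_iff)
  qed
  \<comment> \<open>Summing inside \<open>ennreal\<close> requires nonnegative terms; each one is
    the integral of a square over \<open>N\<close>.\<close>
  also have "\<dots> = ennreal (\<Sum>k\<le>K. (expectation (\<lambda>\<omega>. (G k \<omega>)\<^sup>2) - (a $ k)\<^sup>2) / real N)"
  proof (rule sum_ennreal)
    fix k assume "k \<in> {..K}"
    then have "0 \<le> expectation (\<lambda>\<omega>. (G k \<omega>)\<^sup>2) - (a $ k)\<^sup>2"
      using hX2[of k] integral_nonneg_AE[OF AE_I2, of M "\<lambda>\<omega>. (h k (?X \<omega>))\<^sup>2"]
      by (simp only: has_bochner_integral_iff atMost_iff zero_le_power2)
    then show "0 \<le> (expectation (\<lambda>\<omega>. (G k \<omega>)\<^sup>2) - (a $ k)\<^sup>2) / real N" by simp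
  qed
  finally show ?thesis
    by (simp add: G_def sum_divide_distrib)
qed

section \<open>The upper bound\<close>

text \<open>Cauchy-Schwarz is applied to the payoff, whose coefficients have norm one, and to the
  dual function, whose coefficients are at most \<open>C\<close>. One factor \<open>Suc K\<close>
  comes from the row of the inverse and two from the double sum of moments, each at most its value
  at \<open>m = j = K\<close>.\<close>

lemma expectation_payoff_dual_psi_sq_le:
  assumes a: "(\<Sum>m\<le>K. (a $ m)\<^sup>2) = 1" and k: "k \<le> K"
  shows "expectation (\<lambda>\<omega>. (payoff W t\<^sub>2 K a \<omega> * dual_psi K k (S t\<^sub>1 \<omega>))\<^sup>2) \<le>
    real (Suc K) ^ 3 * ((exp t\<^sub>1 + 1) / (exp t\<^sub>1 - 1)) ^ (2 * K) * exp ((real K)\<^sup>2 * (5 * t\<^sub>1 + t\<^sub>2))"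
proof -
  define C where "C = ((exp t\<^sub>1 + 1) / (exp t\<^sub>1 - 1)) ^ K"
  define E where "E = exp ((real K)\<^sup>2 * (5 * t\<^sub>1 + t\<^sub>2))"
  let ?Q = "\<lambda>m j \<omega>. (psi t\<^sub>2 m (S t\<^sub>2 \<omega>))\<^sup>2 * (psi t\<^sub>1 j (S t\<^sub>1 \<omega>))\<^sup>2"
  let ?e = "\<lambda>m j. exp ((real m)\<^sup>2 * t\<^sub>2 + (real j)\<^sup>2 * t\<^sub>1 + 4 * (real m * real j) * t\<^sub>1)"
  have Q: "has_bochner_integral M (?Q m j) (?e m j)" for m j
    using has_bochner_integral_psi_products[of m m j j]
    by (simp add: power2_eq_square algebra_simps)
  have e: "?e m j \<le> E" if "m \<le> K" "j \<le> K" for m j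
  proof -
    have "(real m)\<^sup>2 \<le> (real K)\<^sup>2" "(real j)\<^sup>2 \<le> (real K)\<^sup>2" "real m * real j \<le> (real K)\<^sup>2"
      using that by (auto simp: power2_eq_square intro!: mult_mono)
    then have "(real m)\<^sup>2 * t\<^sub>2 + (real j)\<^sup>2 * t\<^sub>1 + 4 * (real m * real j) * t\<^sub>1 \<le>
        (real K)\<^sup>2 * t\<^sub>2 + (real K)\<^sup>2 * t\<^sub>1 + 4 * (real K)\<^sup>2 * t\<^sub>1"
      using t1_pos t1_less by (intro add_mono mult_right_mono mult_left_mono) auto
    then show ?thesis unfolding E_def by (simp add: algebra_simps)
  qed
  have "(payoff W t\<^sub>2 K a \<omega> * dual_psi K k (S t\<^sub>1 \<omega>))\<^sup>2 \<le>
      real (Suc K) * C\<^sup>2 * (\<Sum>m\<le>K. \<Sum>j\<le>K. ?Q m j \<omega>)" for \<omega>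
  proof -
    have "(payoff W t\<^sub>2 K a \<omega>)\<^sup>2 \<le> (\<Sum>m\<le>K. (psi t\<^sub>2 m (S t\<^sub>2 \<omega>))\<^sup>2)"
      using Cauchy_Schwarz_ineq_sum[of "\<lambda>m. a $ m" "\<lambda>m. psi t\<^sub>2 m (S t\<^sub>2 \<omega>)" "{..K}"]
      unfolding payoff_def a by simp
    moreover have "(dual_psi K k (S t\<^sub>1 \<omega>))\<^sup>2 \<le> real (Suc K) * C\<^sup>2 * (\<Sum>j\<le>K. (psi t\<^sub>1 j (S t\<^sub>1 \<omega>))\<^sup>2)"
    proof -
      have "(gram_inv K $$ (k, j))\<^sup>2 \<le> C\<^sup>2" if "j \<le> K" for j
        using abs_gram_inv_le[OF k that] unfolding C_def by (simp add: abs_le_square_iff[symmetric])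
      then have "(\<Sum>j\<le>K. (gram_inv K $$ (k, j))\<^sup>2) \<le> real (Suc K) * C\<^sup>2"
        using sum_bounded_above[of "{..K}" "\<lambda>j. (gram_inv K $$ (k, j))\<^sup>2" "C\<^sup>2"] by simp
      then show ?thesis
        using Cauchy_Schwarz_ineq_sum[of "\<lambda>j. gram_inv K $$ (k, j)" "\<lambda>j. psi t\<^sub>1 j (S t\<^sub>1 \<omega>)" "{..K}"]
        unfolding dual_psi_def by (elim order_trans) (intro mult_right_mono sum_nonneg, auto)
    qed
    ultimately have "(payoff W t\<^sub>2 K a \<omega>)\<^sup>2 * (dual_psi K k (S t\<^sub>1 \<omega>))\<^sup>2 \<le>
        (\<Sum>m\<le>K. (psi t\<^sub>2 m (S t\<^sub>2 \<omega>))\<^sup>2) * (real (Suc K) * C\<^sup>2 * (\<Sum>j\<le>K. (psi t\<^sub>1 j (S t\<^sub>1 \<omega>))\<^sup>2))"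
      by (intro mult_mono sum_nonneg) auto
    then show ?thesis
      unfolding power_mult_distrib sum_product[symmetric] by (simp only: mult_ac)
  qed
  moreover have sum_Q: "has_bochner_integral M (\<lambda>\<omega>. real (Suc K) * C\<^sup>2 * (\<Sum>m\<le>K. \<Sum>j\<le>K. ?Q m j \<omega>))
      (real (Suc K) * C\<^sup>2 * (\<Sum>m\<le>K. \<Sum>j\<le>K. ?e m j))"
    by (intro has_bochner_integral_mult_right has_bochner_integral_sum Q)
  ultimately have "expectation (\<lambda>\<omega>. (payoff W t\<^sub>2 K a \<omega> * dual_psi K k (S t\<^sub>1 \<omega>))\<^sup>2) \<le>
      real (Suc K) * C\<^sup>2 * (\<Sum>m\<le>K. \<Sum>j\<le>K. ?e m j)"
    using integrable_payoff_dual_psi_sq[of K a k]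
    unfolding has_bochner_integral_iff by (metis (no_types, lifting) integral_mono)
  also have "\<dots> \<le> real (Suc K) * C\<^sup>2 * (\<Sum>m\<le>K. \<Sum>j\<le>K. E)"
    using e by (intro mult_left_mono sum_mono) auto
  also have "\<dots> = real (Suc K) ^ 3 * C\<^sup>2 * E"
    by (simp add: power3_eq_cube)
  finally show ?thesis
    unfolding C_def E_def by (simp add: power_mult[symmetric] mult.commute)
qed

text \<open>The sum over \<open>Suc K\<close> coordinates adds the fourth factor
  \<open>Suc K\<close>; the subtracted squares \<open>(a $ k)\<^sup>2\<close> are dropped.\<close>

lemma mean_square_error_le:
  assumes a: "a \<in> carrier_vec (Suc K)" "euclidean_norm a = 1" and N: "0 < N"
    and copies: "indep_copies P N Z M (borel \<Otimes>\<^sub>M borel) (\<lambda>\<omega>. (S t\<^sub>1 \<omega>, payoff W t\<^sub>2 K a \<omega>))"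
  shows "mean_square_error P (regression_estimator M K (psi t\<^sub>1) (S t\<^sub>1) N Z) a \<le>
    ennreal (real (Suc K) ^ 4 * ((exp t\<^sub>1 + 1) / (exp t\<^sub>1 - 1)) ^ (2 * K) *
      exp ((real K)\<^sup>2 * (5 * t\<^sub>1 + t\<^sub>2)) / real N)"
proof -
  let ?E = "\<lambda>k. expectation (\<lambda>\<omega>. (payoff W t\<^sub>2 K a \<omega> * dual_psi K k (S t\<^sub>1 \<omega>))\<^sup>2)"
  let ?b = "((exp t\<^sub>1 + 1) / (exp t\<^sub>1 - 1)) ^ (2 * K) * exp ((real K)\<^sup>2 * (5 * t\<^sub>1 + t\<^sub>2))"
  have a1: "(\<Sum>m\<le>K. (a $ m)\<^sup>2) = 1"
    using euclidean_norm_sq[of a] a by (simp add: lessThan_Suc_atMost)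
  have "?E k - (a $ k)\<^sup>2 \<le> real (Suc K) ^ 3 * ?b" if "k \<le> K" for k
    using expectation_payoff_dual_psi_sq_le[OF a1 that] zero_le_power2[of "a $ k"]
    unfolding mult.assoc by linarith
  then have "(\<Sum>k\<le>K. ?E k - (a $ k)\<^sup>2) \<le> real (Suc K) * (real (Suc K) ^ 3 * ?b)"
    using sum_bounded_above[of "{..K}" "\<lambda>k. ?E k - (a $ k)\<^sup>2" "real (Suc K) ^ 3 * ?b"] by simp
  also have "\<dots> = real (Suc K) ^ 4 * ?b"
    by (simp add: power_numeral_reduce mult.assoc)
  finally show ?thesis
    unfolding mean_square_error_eq[OF a(1) N copies]
    by (intro ennreal_leI divide_right_mono) (simp_all only: mult.assoc of_nat_0_le_iff)
qed

section \<open>The lower bound from the highest basis function\<close>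

lemma payoff_unit_vec: "payoff W t\<^sub>2 K (unit_vec (Suc K) K) \<omega> = psi t\<^sub>2 K (S t\<^sub>2 \<omega>)"
proof -
  have "payoff W t\<^sub>2 K (unit_vec (Suc K) K) \<omega> = (\<Sum>k\<le>K. if k = K then psi t\<^sub>2 k (S t\<^sub>2 \<omega>) else 0)"
    unfolding payoff_def by (intro sum.cong) auto
  then show ?thesis by simp
qed

text \<open>Cauchy-Schwarz in the expansion of \<open>psi t\<^sub>1 K\<close> bounds its square by
  \<open>Suc K * q\<close> times the sum of the squared dual functions. Multiplying by the squared
  payoff and integrating bounds the sum of second moments from below; the final \<open>- 1\<close>
  is the squared norm of the unit vector.\<close>

lemma mean_square_error_unit_vec_ge:
  assumes N: "0 < N" and copies: "indep_copies P N Z M (borel \<Otimes>\<^sub>M borel)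
    (\<lambda>\<omega>. (S t\<^sub>1 \<omega>, payoff W t\<^sub>2 K (unit_vec (Suc K) K) \<omega>))"
  shows "ennreal ((exp ((real K)\<^sup>2 * (3 * t\<^sub>1 + t\<^sub>2)) / real (Suc K) - 1) / real N) \<le>
    mean_square_error P (regression_estimator M K (psi t\<^sub>1) (S t\<^sub>1) N Z) (unit_vec (Suc K) K)"
proof -
  define a :: "real vec" where "a = unit_vec (Suc K) K"
  let ?G = "\<lambda>k \<omega>. (payoff W t\<^sub>2 K a \<omega> * dual_psi K k (S t\<^sub>1 \<omega>))\<^sup>2"
  have a: "a \<in> carrier_vec (Suc K)" by (simp add: a_def)
  have a1: "(\<Sum>k\<le>K. (a $ k)\<^sup>2) = 1"
  proof -
    have "(\<Sum>k\<le>K. (a $ k)\<^sup>2) = (\<Sum>k\<le>K. if k = K then 1 else 0)"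
      unfolding a_def by (intro sum.cong) auto
    then show ?thesis by simp
  qed
  \<comment> \<open>The largest squared entry in the last row of \<open>gram K\<close>, attained at
    \<open>j = K\<close>.\<close>
  define q where "q = exp (2 * (real K)\<^sup>2 * t\<^sub>1)"
  have "(psi t\<^sub>2 K (S t\<^sub>2 \<omega>) * psi t\<^sub>1 K (S t\<^sub>1 \<omega>))\<^sup>2 \<le> real (Suc K) * q * (\<Sum>k\<le>K. ?G k \<omega>)" for \<omega>
  proof -
    have "(gram K $$ (K, j))\<^sup>2 \<le> q" if "j \<le> K" for j
    proof -
      have "(gram K $$ (K, j))\<^sup>2 = exp (2 * (real K * real j) * t\<^sub>1)"
        using that by (simp add: gram_index exp_double[symmetric] mult_ac)
      also have "\<dots> \<le> q"
        using that t1_pos unfolding q_def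
        by (simp add: power2_eq_square mult_left_mono)
      finally show ?thesis .
    qed
    then have "(\<Sum>j\<le>K. (gram K $$ (K, j))\<^sup>2) \<le> real (Suc K) * q"
      using sum_bounded_above[of "{..K}" "\<lambda>j. (gram K $$ (K, j))\<^sup>2" q] by simp
    then have "(psi t\<^sub>1 K (S t\<^sub>1 \<omega>))\<^sup>2 \<le> real (Suc K) * q * (\<Sum>j\<le>K. (dual_psi K j (S t\<^sub>1 \<omega>))\<^sup>2)"
      using Cauchy_Schwarz_ineq_sum[of "\<lambda>j. gram K $$ (K, j)" "\<lambda>j. dual_psi K j (S t\<^sub>1 \<omega>)" "{..K}"]
      unfolding psi_eq_sum_dual_psi[OF order_refl, of K "S t\<^sub>1 \<omega>"]
      by (elim order_trans) (intro mult_right_mono sum_nonneg, auto)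
    then have "(psi t\<^sub>2 K (S t\<^sub>2 \<omega>))\<^sup>2 * (psi t\<^sub>1 K (S t\<^sub>1 \<omega>))\<^sup>2 \<le>
        (psi t\<^sub>2 K (S t\<^sub>2 \<omega>))\<^sup>2 * (real (Suc K) * q * (\<Sum>j\<le>K. (dual_psi K j (S t\<^sub>1 \<omega>))\<^sup>2))"
      by (intro mult_left_mono) auto
    then show ?thesis
      unfolding power_mult_distrib sum_distrib_left[symmetric] a_def payoff_unit_vec
      by (simp only: mult_ac)
  qed
  moreover have "has_bochner_integral M (\<lambda>\<omega>. real (Suc K) * q * (\<Sum>k\<le>K. ?G k \<omega>))
      (real (Suc K) * q * (\<Sum>k\<le>K. expectation (?G k)))"
    using integrable_payoff_dual_psi_sq
    by (intro has_bochner_integral_mult_right has_bochner_integral_sum)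
      (simp add: has_bochner_integral_iff)
  moreover have "has_bochner_integral M (\<lambda>\<omega>. (psi t\<^sub>2 K (S t\<^sub>2 \<omega>) * psi t\<^sub>1 K (S t\<^sub>1 \<omega>))\<^sup>2)
      (exp ((real K)\<^sup>2 * (5 * t\<^sub>1 + t\<^sub>2)))"
    using has_bochner_integral_psi_products[of K K K K]
    by (simp add: power2_eq_square algebra_simps)
  ultimately have "exp ((real K)\<^sup>2 * (5 * t\<^sub>1 + t\<^sub>2)) \<le> real (Suc K) * q * (\<Sum>k\<le>K. expectation (?G k))"
    unfolding has_bochner_integral_iff by (metis (no_types, lifting) integral_mono)
  \<comment> \<open>Cancelling \<open>q\<close> lowers the coefficient of \<open>t\<^sub>1\<close>
    from 5 to 3.\<close>
  moreover have "exp ((real K)\<^sup>2 * (5 * t\<^sub>1 + t\<^sub>2)) = q * exp ((real K)\<^sup>2 * (3 * t\<^sub>1 + t\<^sub>2))"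
    unfolding q_def exp_add[symmetric] by (simp add: algebra_simps)
  ultimately have "q * exp ((real K)\<^sup>2 * (3 * t\<^sub>1 + t\<^sub>2)) \<le> q * (real (Suc K) * (\<Sum>k\<le>K. expectation (?G k)))"
    by (simp only: mult_ac)
  then have "exp ((real K)\<^sup>2 * (3 * t\<^sub>1 + t\<^sub>2)) \<le> real (Suc K) * (\<Sum>k\<le>K. expectation (?G k))"
    by (rule mult_left_le_imp_le) (simp add: q_def)
  then have "exp ((real K)\<^sup>2 * (3 * t\<^sub>1 + t\<^sub>2)) / real (Suc K) \<le> (\<Sum>k\<le>K. expectation (?G k))"
    by (subst pos_divide_le_eq) (simp_all only: mult.commute of_nat_0_less_iff zero_less_Suc)
  then have "exp ((real K)\<^sup>2 * (3 * t\<^sub>1 + t\<^sub>2)) / real (Suc K) - 1 \<le> (\<Sum>k\<le>K. expectation (?G k) - (a $ k)\<^sup>2)"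
    unfolding sum_subtractf a1 by simp
  then show ?thesis
    unfolding mean_square_error_eq[OF a N copies[folded a_def], folded a_def] a_def[symmetric]
    by (intro ennreal_leI divide_right_mono) auto
qed

section \<open>The worst case over coefficient vectors of norm one\<close>

context
  fixes P :: "nat \<Rightarrow> nat \<Rightarrow> real vec \<Rightarrow> 'b measure"
    and Z :: "nat \<Rightarrow> nat \<Rightarrow> real vec \<Rightarrow> nat \<Rightarrow> 'b \<Rightarrow> real \<times> real"
  assumes copies: "\<And>N K a. a \<in> carrier_vec (Suc K) \<Longrightarrow>
    indep_copies (P N K a) N (Z N K a) M (borel \<Otimes>\<^sub>M borel) (\<lambda>\<omega>. (S t\<^sub>1 \<omega>, payoff W t\<^sub>2 K a \<omega>))"
begin

text \<open>The bound for a single \<open>a\<close> depends on \<open>a\<close> only through its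
  norm, so it bounds the supremum.\<close>

lemma worst_case_mse_le:
  assumes "0 < N"
  shows "worst_case_mse M W t\<^sub>1 t\<^sub>2 P Z N K \<le>
    ennreal (real (Suc K) ^ 4 * ((exp t\<^sub>1 + 1) / (exp t\<^sub>1 - 1)) ^ (2 * K) *
      exp ((real K)\<^sup>2 * (5 * t\<^sub>1 + t\<^sub>2)) / real N)"
  unfolding worst_case_mse_def
proof (rule SUP_least)
  fix a assume "a \<in> {a \<in> carrier_vec (Suc K). euclidean_norm (bm_coeff M W t\<^sub>1 t\<^sub>2 K a) = 1}"
  then have a: "a \<in> carrier_vec (Suc K)" "euclidean_norm a = 1"
    by (auto simp: bm_coeff_eq)
  show "mean_square_error (P N K a) (regression_estimator M K (psi t\<^sub>1) (S t\<^sub>1) N (Z N K a))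
      (bm_coeff M W t\<^sub>1 t\<^sub>2 K a) \<le>
    ennreal (real (Suc K) ^ 4 * ((exp t\<^sub>1 + 1) / (exp t\<^sub>1 - 1)) ^ (2 * K) *
      exp ((real K)\<^sup>2 * (5 * t\<^sub>1 + t\<^sub>2)) / real N)"
    unfolding bm_coeff_eq[OF a(1)] by (rule mean_square_error_le[OF a assms copies[OF a(1)]])
qed

text \<open>The last unit vector has norm one, hence competes in the supremum.\<close>

lemma worst_case_mse_ge:
  assumes "0 < N"
  shows "ennreal ((exp ((real K)\<^sup>2 * (3 * t\<^sub>1 + t\<^sub>2)) / real (Suc K) - 1) / real N) \<le>
    worst_case_mse M W t\<^sub>1 t\<^sub>2 P Z N K"
proof -
  define a :: "real vec" where "a = unit_vec (Suc K) K"
  have a: "a \<in> carrier_vec (Suc K)"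
    by (simp add: a_def)
  have "(\<Sum>i<Suc K. (a $ i)\<^sup>2) = (\<Sum>i<Suc K. if i = K then 1 else 0)"
    unfolding a_def by (intro sum.cong) auto
  also have "\<dots> = 1\<^sup>2" by simp
  finally have "(euclidean_norm a)\<^sup>2 = 1\<^sup>2"
    using a unfolding euclidean_norm_sq by (simp only: carrier_vecD)
  moreover have "0 \<le> euclidean_norm a"
    unfolding euclidean_norm_def by (rule L2_set_nonneg)
  ultimately have "euclidean_norm a = 1"
    using zero_le_one by (rule power2_eq_imp_eq)
  then have "a \<in> {a \<in> carrier_vec (Suc K). euclidean_norm (bm_coeff M W t\<^sub>1 t\<^sub>2 K a) = 1}"
    using a by (simp add: bm_coeff_eq)
  moreover have "ennreal ((exp ((real K)\<^sup>2 * (3 * t\<^sub>1 + t\<^sub>2)) / real (Suc K) - 1) / real N) \<le>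
      mean_square_error (P N K a) (regression_estimator M K (psi t\<^sub>1) (S t\<^sub>1) N (Z N K a))
        (bm_coeff M W t\<^sub>1 t\<^sub>2 K a)"
    unfolding bm_coeff_eq[OF a] unfolding a_def
    by (rule mean_square_error_unit_vec_ge[OF assms copies]) simp
  ultimately show ?thesis
    unfolding worst_case_mse_def by (rule SUP_upper2)
qed

end

end

section \<open>The two limits\<close>

theorem theorem2:
  fixes M :: "'a measure"
    and W :: "real \<Rightarrow> 'a \<Rightarrow> real"
    and t\<^sub>1 t\<^sub>2 :: real
    and P :: "nat \<Rightarrow> nat \<Rightarrow> real vec \<Rightarrow> 'b measure"
    and Z :: "nat \<Rightarrow> nat \<Rightarrow> real vec \<Rightarrow> nat \<Rightarrow> 'b \<Rightarrow> real \<times> real"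
  assumes "0 < t\<^sub>1" and "t\<^sub>1 < t\<^sub>2"
    and "standard_brownian_motion M W"
    and "\<And>N K a. a \<in> carrier_vec (Suc K) \<Longrightarrow>
           indep_copies (P N K a) N (Z N K a) M (borel \<Otimes>\<^sub>M borel)
             (\<lambda>\<omega>. (geometric_bm W t\<^sub>1 \<omega>, payoff W t\<^sub>2 K a \<omega>))"
  shows "(\<forall>\<delta>::real. 0 < \<delta> \<and> \<delta> < 1 \<longrightarrow>
            (\<lambda>N. worst_case_mse M W t\<^sub>1 t\<^sub>2 P Z N
                   (nat \<lfloor>sqrt ((1 - \<delta>) * ln (real N) / (5 * t\<^sub>1 + t\<^sub>2))\<rfloor>))
              \<longlonglongrightarrow> 0) \<and>
         (\<forall>\<delta>::real. 0 < \<delta> \<longrightarrow>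
            (\<lambda>N. worst_case_mse M W t\<^sub>1 t\<^sub>2 P Z N
                   (nat \<lfloor>sqrt ((1 + \<delta>) * ln (real N) / (3 * t\<^sub>1 + t\<^sub>2))\<rfloor>))
              \<longlonglongrightarrow> \<infinity>)"
proof (intro conjI allI impI)
  interpret bm_regression M W t\<^sub>1 t\<^sub>2
    using assms(1-3) by unfold_locales
  fix \<delta> :: real
  {
    assume \<delta>: "0 < \<delta> \<and> \<delta> < 1"
    define d where "d = 5 * t\<^sub>1 + t\<^sub>2"
    define c where "c = (exp t\<^sub>1 + 1) / (exp t\<^sub>1 - 1)"
    \<comment> \<open>In the form required with \<open>\<alpha> = (1 - \<delta>) / d\<close>, for
      which \<open>\<alpha> * d = 1 - \<delta> < 1\<close>.\<close>
    define K where "K N = nat \<lfloor>sqrt ((1 - \<delta>) / d * ln (real N))\<rfloor>" for N :: nat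
    define f where "f N = real (Suc (K N)) ^ 4 * c ^ (2 * K N) * exp ((real (K N))\<^sup>2 * d) / real N" for N
    have d: "0 < d" using assms(1,2) by (simp add: d_def)
    have c: "1 \<le> c" using assms(1) by (simp add: c_def)
    have "f \<longlonglongrightarrow> 0"
      unfolding f_def K_def using \<delta> d c by (intro upper_bound_tendsto_0) auto
    from tendsto_ennrealI[OF this] have lim: "(\<lambda>N. ennreal (f N)) \<longlonglongrightarrow> 0"
      by (simp only: ennreal_0)
    have bound: "worst_case_mse M W t\<^sub>1 t\<^sub>2 P Z N (K N) \<le> ennreal (f N)" if "0 < N" for N
      unfolding f_def c_def d_def
      by (rule worst_case_mse_le[where P = P and Z = Z, OF assms(4) that])
    have upper: "eventually (\<lambda>N. worst_case_mse M W t\<^sub>1 t\<^sub>2 P Z N (K N) \<le> ennreal (f N)) sequentially"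
      using eventually_gt_at_top[of "0::nat"] by eventually_elim (rule bound)
    have lower: "eventually (\<lambda>N. 0 \<le> worst_case_mse M W t\<^sub>1 t\<^sub>2 P Z N (K N)) sequentially"
      by simp
    have "(\<lambda>N. worst_case_mse M W t\<^sub>1 t\<^sub>2 P Z N (K N)) \<longlonglongrightarrow> 0"
      by (rule tendsto_sandwich[OF lower upper tendsto_const lim])
    then show "(\<lambda>N. worst_case_mse M W t\<^sub>1 t\<^sub>2 P Z N
        (nat \<lfloor>sqrt ((1 - \<delta>) * ln (real N) / (5 * t\<^sub>1 + t\<^sub>2))\<rfloor>)) \<longlonglongrightarrow> 0"
      by (simp add: K_def d_def)
  }
  {
    assume \<delta>: "0 < \<delta>"
    define d where "d = 3 * t\<^sub>1 + t\<^sub>2"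
    \<comment> \<open>Here \<open>\<alpha> = (1 + \<delta>) / d\<close>, so that
      \<open>\<alpha> * d = 1 + \<delta> > 1\<close>.\<close>
    define K where "K N = nat \<lfloor>sqrt ((1 + \<delta>) / d * ln (real N))\<rfloor>" for N :: nat
    define f where "f N = (exp ((real (K N))\<^sup>2 * d) / real (Suc (K N)) - 1) / real N" for N
    have d: "0 < d" using assms(1,2) by (simp add: d_def)
    have "filterlim f at_top sequentially"
      unfolding f_def K_def using \<delta> d by (intro lower_bound_at_top) auto
    then have lim: "(\<lambda>N. ennreal (f N)) \<longlonglongrightarrow> \<infinity>"
      by (simp add: ennreal_tendsto_top_eq_at_top)
    have bound: "ennreal (f N) \<le> worst_case_mse M W t\<^sub>1 t\<^sub>2 P Z N (K N)" if "0 < N" for N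
      unfolding f_def d_def
      by (rule worst_case_mse_ge[where P = P and Z = Z, OF assms(4) that])
    have lower: "eventually (\<lambda>N. ennreal (f N) \<le> worst_case_mse M W t\<^sub>1 t\<^sub>2 P Z N (K N)) sequentially"
      using eventually_gt_at_top[of "0::nat"] by eventually_elim (rule bound)
    have upper: "eventually (\<lambda>N. worst_case_mse M W t\<^sub>1 t\<^sub>2 P Z N (K N) \<le> \<infinity>) sequentially"
      by simp
    have "(\<lambda>N. worst_case_mse M W t\<^sub>1 t\<^sub>2 P Z N (K N)) \<longlonglongrightarrow> \<infinity>"
      by (rule tendsto_sandwich[OF lower upper lim tendsto_const])
    then show "(\<lambda>N. worst_case_mse M W t\<^sub>1 t\<^sub>2 P Z N
        (nat \<lfloor>sqrt ((1 + \<delta>) * ln (real N) / (3 * t\<^sub>1 + t\<^sub>2))\<rfloor>)) \<longlonglongrightarrow> \<infinity>"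
      by (simp add: K_def d_def)
  }
qed

end
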